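(* Let $n \geq 1$ be an integer and let $p > n$. There exists a constant $C = C(n,p) > 0$, depending only on $n$ and $p$, such that for every domain $\Omega \subset \mathbb{R}^n$ containing the origin and having finite volume $|\Omega|$, and for all $u \in C_c^\infty(\Omega \setminus \{0\})$, $$\sup_{x \in \Omega} |u(x)| \leq C\, |\Omega|^{1/n - 1/p} \left[ \int_\Omega |\nabla u|^p\, dx - \left(\frac{p-n}{p}\right)^p \int_\Omega \frac{|u|^p}{|x|^p}\, dx \right]^{1/p}.$$
   Context: A domain is an open connected subset of $\mathbb{R}^n$; $|\Omega|$ denotes its Lebesgue measure. Functions in $C_c^\infty(\Omega\setminus\{0\})$ are extended by zero outside their support. *)

theory Defs
  imports "HOL-Analysis.Analysis"
begin

definition gradient :: "('a::real_inner \<Rightarrow> real) \<Rightarrow> 'a \<Rightarrow> 'a" where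
  "gradient f x = (THE D. GDERIV f x :> D)"

lemma gradient_eq:
  assumes "GDERIV f x :> D"
  shows "gradient f x = D"
  unfolding gradient_def
proof (rule the_equality)
  fix D'
  assume "GDERIV f x :> D'"
  with assms have "(\<lambda>h. inner h D') = (\<lambda>h. inner h D)"
    unfolding gderiv_def by (rule has_derivative_unique[rotated])
  then show "D' = D"
    by (metis inner_commute vector_eq_ldot)
qed (rule assms)

(* Continuous differentiability of order k on an open set U; gradient f x $ i is the i-th
   partial derivative. *)
fun Ck_on :: "nat \<Rightarrow> (real ^ 'n) set \<Rightarrow> (real ^ 'n \<Rightarrow> real) \<Rightarrow> bool" where
  "Ck_on 0 U f \<longleftrightarrow> continuous_on U f"
| "Ck_on (Suc k) U f \<longleftrightarrow> f differentiable_on U \<and> (\<forall>i. Ck_on k U (\<lambda>x. gradient f x $ i))"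

(* C_c^infinity(U) for open U. Its elements are total functions that vanish outside U (the
   extension by zero), which is enforced by the support condition. *)
definition test_functions :: "(real ^ 'n) set \<Rightarrow> (real ^ 'n \<Rightarrow> real) set" where
  "test_functions U =
     {u. (\<forall>k. Ck_on k U u) \<and> compact (closure {x. u x \<noteq> 0}) \<and> closure {x. u x \<noteq> 0} \<subseteq> U}"

(* Nonnegative on test functions by Hardy's inequality. As powr is total, a statement taking the
   1/p-th power of this quantity has to assert nonnegativity explicitly. *)
definition hardy_difference :: "real \<Rightarrow> (real ^ 'n) set \<Rightarrow> (real ^ 'n \<Rightarrow> real) \<Rightarrow> real" where
  "hardy_difference p \<Omega> u =
     (LINT x:\<Omega>|lborel. norm (gradient u x) powr p)
     - ((p - real CARD('n)) / p) powr p * (LINT x:\<Omega>|lborel. \<bar>u x\<bar> powr p / norm x powr p)"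

end

theory Submission
  imports Defs
begin

text \<open>
  Write $H = (p-n)/p$ and $I = \<integral> |\<nabla> u|^p - H^p \<integral> |u|^p/|x|^p$. The constant $H^p$ is the best
  one in Hardy's inequality, whose virtual extremal is $|x|^H$; the point is that the difference $I$
  still controls the supremum of $u$.

  For $n \<ge> 2$, hence $p > 2$, compare $\<nabla> u$ with the gradient it would have if $u$ were a multiple of
  $|x|^H$. The remainder $b = \<nabla> u - H u x / |x|^2$ satisfies $b = |x|^H \<nabla> v$ for $v = |x|^{-H} u$.
  Uniform convexity of $|\<cdot>|^p$ gives a pointwise lower bound of $|\<nabla> u|^p$ that contains
  $2^{1-p} |b|^p$ and whose other terms integrate to exactly the Hardy term, because $\<integral> x \<cdot> \<nabla> W = - n \<integral> W$ for
  $W = |u|^p / |x|^p$; what is left is $I \<ge> 2^{1-p} \<integral> |b|^p$ (\<open>remainder_le_hardy\<close>).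
  On a cube of side comparable to $h$ around $x$ that stays away from the origin, the weight $|x|^H$ is
  essentially constant, so Morrey's inequality (\<open>Morrey_cube\<close>) bounds $|x|^H$ times the
  oscillation of $v$ by a multiple of $h^H (\<integral> |b|^p)^{1/p}$ (\<open>oscillation_v\<close>).
  Let $h$ be $|\<Omega>|^{1/n}$. If $|x|$ is large compared to $h$, the cube is too big to fit into $\<Omega>$
  and contains a zero of $u$, which bounds $|u(x)|$. If $|x|$ is small, compare $x$ with $\<kappa> x$ for a
  fixed $\<kappa> > 1$: then $|u(x)| \<le> \<kappa>^{-H} |u(\<kappa> x)| + A$, since passing from $v$ back to $u$ gains the
  factor $\<kappa>^{-H} < 1$. At a maximum point of $|u|$ this gives $max |u| \<le> A / (1 - \<kappa>^{-H})$
  (\<open>sup_le_remainder\<close>).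

  For $n = 1$ the exponent may be less than $2$ and $|\<cdot>|^p$ is no longer uniformly convex of power type
  $p$. On a half line $[0,L]$ with $w(L) = 0$ one can calibrate instead: for a constant
  $0 \<le> m \<le> t^{1-p}$ the function $\<psi>(t) = H^{p-1} (t^{1-p} - m)$ satisfies
  $(\<psi> |w|^p)' \<le> |w'|^p - H^p |w|^p / t^p$. Using $m = 0$ to the left of a point $y$ and
  $m = L^{1-p}$ to its right, the two boundary terms at $y$ differ by exactly
  $H^{p-1} L^{1-p} |w(y)|^p$ (\<open>hardy_half_line\<close>).
\<close>

section \<open>Convexity inequalities for powers of norms\<close>

text \<open>
  The convex function $x^p$ lies above its tangent at $y$; this is Young's inequality in disguise.
\<close>

lemma powr_tangent:
  fixes p x y :: real
  assumes "p > 1" "x \<ge> 0" "y \<ge> 0"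
  shows "p * y powr (p - 1) * x \<le> x powr p + (p - 1) * y powr p"
proof -
  have "x * y powr (p - 1) \<le> x powr p / p + (y powr (p - 1)) powr (p / (p - 1)) / (p / (p - 1))"
    using assms by (intro Youngs_inequality) (auto simp: field_simps)
  also have "(y powr (p - 1)) powr (p / (p - 1)) = y powr p"
    using assms by (simp add: powr_powr)
  finally show ?thesis
    using assms by (simp add: field_simps)
qed

lemma powr_midpoint:
  fixes q x y :: real
  assumes "q > 1" "x \<ge> 0" "y \<ge> 0"
  shows "2 * ((x + y) / 2) powr q \<le> x powr q + y powr q"
proof -
  let ?m = "(x + y) / 2"
  have m: "?m \<ge> 0" using assms by simp
  have "q * ?m powr (q - 1) * x + q * ?m powr (q - 1) * y
      \<le> x powr q + y powr q + 2 * (q - 1) * ?m powr q"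
    using powr_tangent[OF assms(1,2) m] powr_tangent[OF assms(1,3) m] by (simp add: algebra_simps)
  moreover have "q * ?m powr (q - 1) * x + q * ?m powr (q - 1) * y = 2 * q * ?m powr q"
  proof -
    have "?m powr q = ?m powr (q - 1) * ?m powr 1"
      unfolding powr_add[symmetric] by simp
    then have "?m powr q = ?m powr (q - 1) * ?m"
      using m by simp
    then show ?thesis by (simp add: algebra_simps)
  qed
  ultimately show ?thesis by (simp add: algebra_simps)
qed

lemma powr_superadditive:
  fixes q x y :: real
  assumes "q \<ge> 1" "x \<ge> 0" "y \<ge> 0"
  shows "x powr q + y powr q \<le> (x + y) powr q"
proof -
  have split: "z powr q = z * z powr (q - 1)" if "z \<ge> 0" for z :: real
    using that powr_add[of z 1 "q - 1"] by simp
  have "x * x powr (q - 1) + y * y powr (q - 1) \<le> x * (x + y) powr (q - 1) + y * (x + y) powr (q - 1)"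
    using assms by (intro add_mono mult_left_mono powr_mono2) auto
  also have "\<dots> = (x + y) * (x + y) powr (q - 1)" by (simp add: algebra_simps)
  finally show ?thesis using assms split by simp
qed

text \<open>
  Clarkson's inequality for exponents above 2. By the parallelogram law the squares of the half sum and
  the half difference add up to the mean of the squares, and the power $p/2$ is superadditive and convex.
\<close>

lemma clarkson_inner:
  fixes x y :: "'a::real_inner"
  assumes "p > 2"
  shows "2 * (norm ((x + y) /\<^sub>R 2) powr p + norm ((x - y) /\<^sub>R 2) powr p)
     \<le> norm x powr p + norm y powr p"
proof -
  have sq: "norm z powr p = (z \<bullet> z) powr (p / 2)" for z :: 'a
  proof (cases "z = 0")
    case False
    then have "z \<bullet> z = norm z powr 2"
      by (simp add: dot_square_norm)
    then show ?thesis by (simp only: powr_powr) simp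
  qed (use assms in simp)
  let ?s = "(x + y) /\<^sub>R 2" and ?d = "(x - y) /\<^sub>R 2"
  have "norm ?s powr p + norm ?d powr p \<le> (?s \<bullet> ?s + ?d \<bullet> ?d) powr (p / 2)"
    unfolding sq using assms by (intro powr_superadditive) auto
  also have "?s \<bullet> ?s + ?d \<bullet> ?d = (x \<bullet> x + y \<bullet> y) / 2"
    by (simp add: inner_add inner_diff inner_commute field_simps)
  also have "2 * ((x \<bullet> x + y \<bullet> y) / 2) powr (p / 2) \<le> norm x powr p + norm y powr p"
    unfolding sq using assms by (intro powr_midpoint) auto
  finally show ?thesis by simp
qed

text \<open>
  For $a = 0$ and $p \<le> 2$ the factor \<open>norm a powr (p - 2)\<close> is 0, so that the linear term
  vanishes, in agreement with the gradient of $|\<cdot>|^p$ at the origin.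
\<close>

lemma norm_powr_tangent:
  fixes a y :: "'a::real_inner"
  assumes "p > 1"
  shows "p * (norm a powr (p - 2) * (a \<bullet> y)) \<le> norm y powr p + (p - 1) * norm a powr p"
proof -
  have "norm a powr (p - 2) * (a \<bullet> y) \<le> norm a powr (p - 2) * (norm a * norm y)"
    by (intro mult_left_mono norm_cauchy_schwarz) auto
  also have "\<dots> = norm a powr (p - 1) * norm y"
    using powr_add[of "norm a" "p - 2" 1] by simp
  finally have "p * (norm a powr (p - 2) * (a \<bullet> y)) \<le> p * (norm a powr (p - 1) * norm y)"
    using assms by simp
  also have "\<dots> \<le> norm y powr p + (p - 1) * norm a powr p"
    using powr_tangent[OF assms, of "norm y" "norm a"] by (simp add: mult.assoc)
  finally show ?thesis .
qed

text \<open>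
  Uniform convexity improves the tangent inequality by a multiple of $|y - a|^p$: Clarkson's inequality
  bounds the value at the midpoint of $y$ and $a$ from above, and the tangent at $a$ bounds it from below.
\<close>

lemma norm_powr_uniformly_convex:
  fixes a y :: "'a::real_inner"
  assumes "p > 2"
  shows "(1 - p) * norm a powr p + p * (norm a powr (p - 2) * (a \<bullet> y)) + 2 powr (1 - p) * norm (y - a) powr p
    \<le> norm y powr p"
proof -
  define s where "s = (y + a) /\<^sub>R 2"
  define A T S N where "A = norm a powr p" and "T = norm a powr (p - 2) * (a \<bullet> y)"
    and "S = norm s powr p" and "N = norm (y - a) powr p"
  have "2 * (S + norm ((y - a) /\<^sub>R 2) powr p) \<le> norm y powr p + A"
    unfolding S_def A_def s_def by (rule clarkson_inner) fact
  moreover have "norm ((y - a) /\<^sub>R 2) powr p = 2 powr (- p) * N"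
    unfolding N_def
    by (simp add: powr_divide powr_minus powr_mult divide_simps del: scaleR_diff_right)
  ultimately have clarkson: "2 * (S + 2 powr (- p) * N) \<le> norm y powr p + A"
    by simp
  have "norm a powr (p - 2) * (a \<bullet> s) = (T + A) / 2"
  proof -
    have "A = norm a powr (p - 2) * (a \<bullet> a)"
    proof (cases "a = 0")
      case False
      then show ?thesis
        using powr_add[of "norm a" "p - 2" 2] by (simp add: dot_square_norm A_def)
    qed (use assms in \<open>simp add: A_def\<close>)
    then show ?thesis by (simp add: inner_add_right field_simps T_def s_def)
  qed
  with norm_powr_tangent[of p a s] assms
  have tangent: "p * ((T + A) / 2) \<le> S + (p - 1) * A"
    by (metis A_def S_def one_less_numeral_iff order.strict_trans semiring_norm(76))
  then have "2 * A + p * T + p * A \<le> 2 * S + 2 * (p * A)"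
    by (simp add: field_simps)
  from this clarkson have "A - p * A + p * T + 2 * (2 powr (- p) * N) \<le> norm y powr p"
    by argo
  moreover have "(1 - p) * A + p * T + 2 powr (1 - p) * N = A - p * A + p * T + 2 * (2 powr (- p) * N)"
    using powr_add[of 2 1 "- p"] by (simp add: algebra_simps)
  ultimately show ?thesis
    unfolding A_def[symmetric] T_def[symmetric] N_def[symmetric] by simp
qed

lemma has_real_derivative_abs_powr:
  fixes t :: real
  assumes "p > 1"
  shows "((\<lambda>t. \<bar>t\<bar> powr p) has_real_derivative p * (\<bar>t\<bar> powr (p - 2) * t)) (at t)"
proof (cases "t = 0")
  case True
  have "((\<lambda>h. \<bar>h::real\<bar> powr (p - 1)) \<longlongrightarrow> \<bar>0\<bar> powr (p - 1)) (at 0)"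
    using assms by (intro tendsto_intros) auto
  then have *: "((\<lambda>h. \<bar>h::real\<bar> powr (p - 1)) \<longlongrightarrow> 0) (at 0)"
    by simp
  have "((\<lambda>h. \<bar>h::real\<bar> powr p / h) \<longlongrightarrow> 0) (at 0)"
  proof (rule Lim_null_comparison[OF _ *], rule eventuallyI)
    fix h :: real
    show "norm (\<bar>h\<bar> powr p / h) \<le> \<bar>h\<bar> powr (p - 1)"
      by (cases "h = 0") (auto simp: powr_diff)
  qed
  then show ?thesis
    using True assms by (simp add: DERIV_def)
next
  case False
  have "((\<lambda>t. \<bar>t\<bar> powr p) has_real_derivative (p * \<bar>t\<bar> powr (p - 1) * sgn t)) (at t)"
    using False GDERIV_norm[of t]
    by (auto intro!: DERIV_chain'[OF _ has_real_derivative_powr, THEN DERIV_cong, of abs] simp: mult_ac)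
  also have "p * \<bar>t\<bar> powr (p - 1) * sgn t = p * (\<bar>t\<bar> powr (p - 2) * t)"
    using False powr_add[of "\<bar>t\<bar>" "p - 2" 1] by (simp add: abs_mult_sgn mult.assoc abs_sgn_eq sgn_mult_abs)
  finally show ?thesis .
qed

lemma continuous_on_signed_powr:
  assumes "p > 1"
  shows "continuous_on S (\<lambda>t::real. \<bar>t\<bar> powr (p - 2) * t)"
proof (rule continuous_at_imp_continuous_on, intro ballI)
  fix t :: real
  show "isCont (\<lambda>t::real. \<bar>t\<bar> powr (p - 2) * t) t"
  proof (cases "t = 0")
    case True
    have "((\<lambda>h. \<bar>h::real\<bar> powr (p - 1)) \<longlongrightarrow> \<bar>0\<bar> powr (p - 1)) (at 0)"
      using assms by (intro tendsto_intros) auto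
    then have *: "((\<lambda>h. \<bar>h::real\<bar> powr (p - 1)) \<longlongrightarrow> 0) (at 0)"
      by simp
    have "((\<lambda>h::real. \<bar>h\<bar> powr (p - 2) * h) \<longlongrightarrow> 0) (at 0)"
    proof (rule Lim_null_comparison[OF _ *], rule eventuallyI)
      fix h :: real
      show "norm (\<bar>h\<bar> powr (p - 2) * h) \<le> \<bar>h\<bar> powr (p - 1)"
        using powr_add[of "\<bar>h\<bar>" "p - 2" 1] by (simp add: abs_mult)
    qed
    then show ?thesis using True by (simp add: isCont_def)
  qed (auto intro!: continuous_intros)
qed

section \<open>Morrey's inequality on boxes\<close>

lemma GDERIV_imp_continuous_on:
  assumes "\<And>x. x \<in> S \<Longrightarrow> GDERIV f x :> g x"
  shows "continuous_on S f"
  using assms unfolding gderiv_def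
  by (meson continuous_at_imp_continuous_on has_derivative_continuous)

lemma has_derivative_along_segment:
  assumes "GDERIV f (x + t *\<^sub>R h) :> D"
  shows "((\<lambda>t. f (x + t *\<^sub>R h)) has_vector_derivative D \<bullet> h) (at t within S)"
proof -
  have "((\<lambda>t. x + t *\<^sub>R h) has_derivative (\<lambda>k. k *\<^sub>R h)) (at t within S)"
    by (auto intro!: derivative_eq_intros)
  from has_derivative_compose[OF this assms[unfolded gderiv_def]] show ?thesis
    unfolding has_vector_derivative_def by (simp add: inner_commute)
qed

text \<open>
  The integral over the box of $f(x + t(y - x))$ in $y$, as a function $\<phi>(t)$, joins
  $|Q| f(x)$ at $t = 0$ to the integral of $f$ at $t = 1$. Its derivative is controlled by the gradient on the box
  shrunk by $t$ towards $x$; rescaling that box costs $t^{-n}$ in the integral of $|g|^p$, hence $t^{-n/p}$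
  after Young's inequality, which is integrable at 0 precisely because $p > n$. Comparison with the
  primitive $\<Phi>$ of this bound gives the claim.
\<close>

lemma abs_integral_deviation_le:
  fixes f :: "'a::euclidean_space \<Rightarrow> real"
  assumes f: "\<And>x. GDERIV f x :> g x" and g: "continuous_on UNIV g"
    and p: "p > real DIM('a)" and x: "x \<in> cbox a b"
    and d: "\<And>y. y \<in> cbox a b \<Longrightarrow> norm (y - x) \<le> d"
    and s: "s > 0"
    and G: "integral (cbox a b) (\<lambda>y. norm (g y) powr p) \<le> s powr p * measure lborel (cbox a b)"
  shows "\<bar>integral (cbox a b) f - measure lborel (cbox a b) * f x\<bar>
    \<le> 2 * d * s * measure lborel (cbox a b) / (1 - DIM('a) / p)"
proof -
  let ?Q = "cbox a b" and ?n = "real DIM('a)"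
  define H where "H = 1 - ?n / p"
  have "?n > 0" by simp
  then have p0: "p > 0" using p by linarith
  have p1: "p > 1" using p DIM_ge_Suc0[where 'a='a] by linarith
  have H: "H > 0" "H < 1" using p p0 \<open>?n > 0\<close> by (auto simp: H_def field_simps)
  have d0: "d \<ge> 0" using d[OF x] by simp
  have contf: "continuous_on UNIV f" by (rule GDERIV_imp_continuous_on) (rule f)
  define \<phi> where "\<phi> t = integral ?Q (\<lambda>y. f (x + t *\<^sub>R (y - x)))" for t
  define \<phi>' where "\<phi>' t = integral ?Q (\<lambda>y. g (x + t *\<^sub>R (y - x)) \<bullet> (y - x))" for t
  define \<Phi> where "\<Phi> t = 2 * d * s * measure lborel ?Q / H * t powr H" for t
  have cg: "continuous_on S (\<lambda>z. g (h z))" if "continuous_on S h" for S and h :: "'b::topological_space \<Rightarrow> 'a"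
    by (rule continuous_on_compose2[OF g that]) auto
  have cf: "continuous_on S (\<lambda>z. f (h z))" if "continuous_on S h" for S and h :: "'b::topological_space \<Rightarrow> 'a"
    by (rule continuous_on_compose2[OF contf that]) auto
  have cgp: "continuous_on S (\<lambda>z. norm (g (h z)) powr p)"
    if "continuous_on S h" for S and h :: "'b::topological_space \<Rightarrow> 'a"
    by (intro continuous_on_powr' continuous_intros cg that) (use p0 in auto)
  have \<phi>_deriv: "(\<phi> has_vector_derivative \<phi>' t) (at t)" for t
    unfolding \<phi>_def \<phi>'_def
  proof (rule leibniz_rule_vector_derivative[where U = UNIV])
    show "((\<lambda>t. f (x + t *\<^sub>R (y - x))) has_vector_derivative g (x + t *\<^sub>R (y - x)) \<bullet> (y - x)) (at t)" for t y
      by (rule has_derivative_along_segment) (rule f)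
    show "(\<lambda>y. f (x + t *\<^sub>R (y - x))) integrable_on ?Q" for t
      by (intro integrable_continuous cf continuous_intros)
    show "continuous_on (UNIV \<times> ?Q) (\<lambda>(t, y). g (x + t *\<^sub>R (y - x)) \<bullet> (y - x))"
      unfolding split_beta by (intro continuous_intros cg)
  qed auto
  have \<phi>'_le: "\<bar>\<phi>' t\<bar> \<le> 2 * d * s * measure lborel ?Q * t powr (H - 1)" if t: "0 < t" "t < 1" for t
  proof -
    \<comment> \<open>The expected size of the gradient on the shrunk box: at this threshold both terms of the
      inequality \<open>young\<close> below have the same bound.\<close>
    define M where "M = s * t powr (H - 1)"
    define J where "J = integral ?Q (\<lambda>y. norm (g (x + t *\<^sub>R (y - x))) powr p)"
    have M: "M > 0" using s t by (simp add: M_def)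
    have J: "J \<le> s powr p * measure lborel ?Q / t powr ?n"
    proof -
      let ?A = "t *\<^sub>R a + (x - t *\<^sub>R x)" and ?B = "t *\<^sub>R b + (x - t *\<^sub>R x)"
      have ab: "(?A - (x - t *\<^sub>R x)) /\<^sub>R t = a" "(?B - (x - t *\<^sub>R x)) /\<^sub>R t = b"
        using t by auto
      have "((\<lambda>y. norm (g y) powr p) has_integral integral (cbox ?A ?B) (\<lambda>y. norm (g y) powr p)) (cbox ?A ?B)"
        by (intro integrable_integral integrable_continuous cgp continuous_intros)
      from has_integral_affinity'[OF this t(1), of "x - t *\<^sub>R x", unfolded ab]
      have "((\<lambda>y. norm (g (x + t *\<^sub>R (y - x))) powr p) has_integral
          integral (cbox ?A ?B) (\<lambda>y. norm (g y) powr p) /\<^sub>R t ^ DIM('a)) ?Q"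
        by (simp add: algebra_simps)
      then have "J = integral (cbox ?A ?B) (\<lambda>y. norm (g y) powr p) / t powr ?n"
        unfolding J_def using t by (simp add: integral_unique powr_realpow divide_inverse mult.commute)
      also have "\<dots> \<le> integral ?Q (\<lambda>y. norm (g y) powr p) / t powr ?n"
      proof (intro divide_right_mono integral_subset_le)
        show "cbox ?A ?B \<subseteq> ?Q"
        proof
          fix z assume "z \<in> cbox ?A ?B"
          then have z: "t * (a \<bullet> i) + (x \<bullet> i - t * (x \<bullet> i)) \<le> z \<bullet> i"
             "z \<bullet> i \<le> t * (b \<bullet> i) + (x \<bullet> i - t * (x \<bullet> i))" if "i \<in> Basis" for i
            using that by (auto simp: mem_box inner_simps)
          show "z \<in> ?Q"
          proof (simp add: mem_box, intro ballI)
            fix i :: 'a assume i: "i \<in> Basis"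
            have xi: "a \<bullet> i \<le> x \<bullet> i" "x \<bullet> i \<le> b \<bullet> i" using x i by (auto simp: mem_box)
            have "0 \<le> (1 - t) * (x \<bullet> i - a \<bullet> i)" "0 \<le> (1 - t) * (b \<bullet> i - x \<bullet> i)"
              using xi t by auto
            then show "a \<bullet> i \<le> z \<bullet> i \<and> z \<bullet> i \<le> b \<bullet> i"
              using z[OF i] by (simp add: algebra_simps)
          qed
        qed
      qed (auto intro!: integrable_continuous cgp continuous_intros)
      also have "\<dots> \<le> s powr p * measure lborel ?Q / t powr ?n"
        by (intro divide_right_mono G) auto
      finally show ?thesis .
    qed
    have young: "r \<le> M + M powr (1 - p) * r powr p" if "r \<ge> 0" for r
    proof (cases "r \<le> M")
      case False
      then have "r powr (1 - p) \<le> M powr (1 - p)"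
        using M p1 by (intro powr_mono2') auto
      then have "r powr (1 - p) * r powr p \<le> M powr (1 - p) * r powr p"
        by (intro mult_right_mono) auto
      moreover have "r powr (1 - p) * r powr p = r"
        using False M by (simp flip: powr_add)
      ultimately show ?thesis using M by simp
    qed (simp add: add_increasing2)
    have "norm (\<phi>' t) \<le> integral ?Q (\<lambda>y. d * (M + M powr (1 - p) * norm (g (x + t *\<^sub>R (y - x))) powr p))"
      unfolding \<phi>'_def
    proof (rule integral_norm_bound_integral)
      show "(\<lambda>y. g (x + t *\<^sub>R (y - x)) \<bullet> (y - x)) integrable_on ?Q"
        by (intro integrable_continuous continuous_intros cg)
      show "(\<lambda>y. d * (M + M powr (1 - p) * norm (g (x + t *\<^sub>R (y - x))) powr p)) integrable_on ?Q"
        by (intro integrable_continuous continuous_intros cgp)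
      fix y assume "y \<in> ?Q"
      have "norm (g (x + t *\<^sub>R (y - x)) \<bullet> (y - x)) \<le> norm (g (x + t *\<^sub>R (y - x))) * norm (y - x)"
        by (rule Cauchy_Schwarz_ineq2[folded real_norm_def])
      also have "\<dots> \<le> norm (g (x + t *\<^sub>R (y - x))) * d"
        using d[OF \<open>y \<in> ?Q\<close>] by (intro mult_left_mono) auto
      also have "\<dots> \<le> (M + M powr (1 - p) * norm (g (x + t *\<^sub>R (y - x))) powr p) * d"
        using d0 by (intro mult_right_mono young) auto
      finally show "norm (g (x + t *\<^sub>R (y - x)) \<bullet> (y - x))
          \<le> d * (M + M powr (1 - p) * norm (g (x + t *\<^sub>R (y - x))) powr p)"
        by (simp add: mult.commute)
    qed
    also have "\<dots> = d * (M * measure lborel ?Q + M powr (1 - p) * J)"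
    proof -
      have "integral ?Q (\<lambda>y. M + M powr (1 - p) * norm (g (x + t *\<^sub>R (y - x))) powr p)
          = integral ?Q (\<lambda>y. M) + integral ?Q (\<lambda>y. M powr (1 - p) * norm (g (x + t *\<^sub>R (y - x))) powr p)"
        by (intro integral_add integrable_continuous continuous_intros cgp)
      then show ?thesis by (simp add: J_def mult.commute)
    qed
    also have "\<dots> \<le> d * (M * measure lborel ?Q + M powr (1 - p) * (s powr p * measure lborel ?Q / t powr ?n))"
      by (intro mult_left_mono add_left_mono J d0) auto
    also have "M powr (1 - p) * (s powr p * measure lborel ?Q / t powr ?n) = M * measure lborel ?Q"
    proof -
      have "(H - 1) * (1 - p) = (H - 1) + ?n"
        using p0 by (simp add: H_def field_simps)
      then have "M powr (1 - p) = s powr (1 - p) * (t powr (H - 1) * t powr ?n)"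
        using s t by (simp add: M_def powr_mult powr_powr flip: powr_add)
      moreover have "s powr (1 - p) * s powr p = s"
        using s by (simp flip: powr_add)
      ultimately show ?thesis using t by (simp add: M_def field_simps)
    qed
    finally show ?thesis by (simp add: M_def algebra_simps)
  qed
  have "norm (\<phi> 1 - \<phi> 0) \<le> \<Phi> 1 - \<Phi> 0"
  proof (rule differentiable_bound_general)
    show "continuous_on {0..1} \<phi>"
      using \<phi>_deriv by (intro continuous_at_imp_continuous_on) (auto intro: has_vector_derivative_continuous)
    show "continuous_on {0..1} \<Phi>"
      unfolding \<Phi>_def by (intro continuous_intros continuous_on_powr') (use H in auto)
    show "(\<phi> has_vector_derivative \<phi>' t) (at t)" for t by (rule \<phi>_deriv)
    show "(\<Phi> has_vector_derivative 2 * d * s * measure lborel ?Q * t powr (H - 1)) (at t)" if "0 < t" for t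
      unfolding \<Phi>_def has_real_derivative_iff_has_vector_derivative[symmetric]
      using that H by (auto intro!: derivative_eq_intros)
    show "norm (\<phi>' t) \<le> 2 * d * s * measure lborel ?Q * t powr (H - 1)" if "0 < t" "t < 1" for t
      using \<phi>'_le[OF that] by simp
  qed auto
  moreover have "\<phi> 1 = integral ?Q f" "\<phi> 0 = measure lborel ?Q * f x"
    by (auto simp: \<phi>_def)
  ultimately show ?thesis
    by (simp add: \<Phi>_def H_def)
qed

text \<open>
  Both values are compared with the mean over the box. Choosing \<open>s\<close> as the mean of $|g|^p$ to the
  power $1/p$ is possible unless that mean is 0, in which case \<open>s\<close> tends to 0.
\<close>

theorem Morrey_cube:
  fixes f :: "'a::euclidean_space \<Rightarrow> real"
  assumes f: "\<And>x. GDERIV f x :> g x" and g: "continuous_on UNIV g"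
    and p: "p > real DIM('a)" and x: "x \<in> cbox a b" and y: "y \<in> cbox a b"
    and d: "\<And>z w. z \<in> cbox a b \<Longrightarrow> w \<in> cbox a b \<Longrightarrow> norm (z - w) \<le> d"
    and Q: "measure lborel (cbox a b) > 0"
  shows "\<bar>f x - f y\<bar> \<le> 4 * d / (1 - DIM('a) / p) *
     (integral (cbox a b) (\<lambda>y. norm (g y) powr p) / measure lborel (cbox a b)) powr (1 / p)"
proof -
  let ?Q = "cbox a b" and ?n = "real DIM('a)"
  define H where "H = 1 - ?n / p"
  define A where "A = integral ?Q (\<lambda>y. norm (g y) powr p) / measure lborel ?Q"
  have "?n > 0" by simp
  then have p0: "p > 0" using p by linarith
  have H: "H > 0" using p p0 by (auto simp: H_def field_simps)
  have d0: "d \<ge> 0" using d[OF x x] by simp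
  have A: "A \<ge> 0"
    unfolding A_def by (intro divide_nonneg_nonneg integral_nonneg integrable_continuous
        continuous_on_powr' continuous_intros continuous_on_subset[OF g]) (use p0 Q in auto)
  have bound: "\<bar>f x - f y\<bar> \<le> 4 * d / H * s" if s: "s > 0" "A \<le> s powr p" for s
  proof -
    have G: "integral ?Q (\<lambda>y. norm (g y) powr p) \<le> s powr p * measure lborel ?Q"
      using s(2) Q by (simp add: A_def field_simps)
    have 1: "\<bar>integral ?Q f - measure lborel ?Q * f z\<bar> \<le> 2 * d * s * measure lborel ?Q / H" if "z \<in> ?Q" for z
      using abs_integral_deviation_le[OF f g p that d[OF _ that] s(1) G] by (simp add: H_def)
    have "measure lborel ?Q * \<bar>f x - f y\<bar> = \<bar>measure lborel ?Q * f x - measure lborel ?Q * f y\<bar>"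
      using Q by (simp add: abs_mult flip: right_diff_distrib)
    also have "\<dots> \<le> 2 * (2 * d * s * measure lborel ?Q / H)"
      using 1[OF x] 1[OF y] by linarith
    also have "\<dots> = measure lborel ?Q * (4 * d / H * s)" by simp
    finally show ?thesis using Q by (rule mult_left_le_imp_le)
  qed
  have "\<bar>f x - f y\<bar> \<le> 4 * d / H * A powr (1 / p)"
  proof (cases "A = 0")
    case False
    then show ?thesis using A p0 by (intro bound) (auto simp: powr_powr)
  next
    case True
    have "((\<lambda>s. 4 * d / H * s) \<longlongrightarrow> 4 * d / H * 0) (at_right 0)"
      by (intro tendsto_intros)
    moreover have "eventually (\<lambda>s. \<bar>f x - f y\<bar> \<le> 4 * d / H * s) (at_right 0)"
      using eventually_at_right_less[of "0::real"] by eventually_elim (rule bound, auto simp: True)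
    ultimately have "\<bar>f x - f y\<bar> \<le> 4 * d / H * 0"
      by (rule tendsto_lowerbound) simp
    then show ?thesis using True by simp
  qed
  then show ?thesis by (simp add: H_def A_def)
qed

section \<open>Integrals of compactly supported functions\<close>

lemma GDERIV_zero_outside:
  assumes "closed K" "\<And>x. x \<notin> K \<Longrightarrow> f x = 0" "x \<notin> K"
  shows "GDERIV f x :> 0"
  unfolding gderiv_def
proof (rule has_derivative_transform_within_open[where f = "\<lambda>_. 0"])
  show "open (- K)" "x \<in> - K" using assms by (simp_all add: open_Compl)
qed (use assms in auto)

lemma gradient_zero_outside:
  assumes "\<And>x. GDERIV f x :> g x" "compact K" "\<And>x. x \<notin> K \<Longrightarrow> f x = 0" "x \<notin> K"
  shows "g x = 0"
proof -
  have "GDERIV f x :> 0"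
    by (rule GDERIV_zero_outside[OF compact_imp_closed[OF assms(2)] assms(3,4)])
  with assms(1) show ?thesis by (metis gradient_eq)
qed

lemma integrable_compact_support:
  fixes f :: "'a::euclidean_space \<Rightarrow> real"
  assumes "continuous_on UNIV f" "compact K" "\<And>x. x \<notin> K \<Longrightarrow> f x = 0"
  shows "integrable lborel f"
proof -
  have "integrable lborel (\<lambda>x. indicator K x *\<^sub>R f x)"
    by (rule borel_integrable_compact) (use assms continuous_on_subset in blast)+
  also have "(\<lambda>x. indicator K x *\<^sub>R f x) = f"
    using assms(3) by (auto simp: indicator_def fun_eq_iff)
  finally show ?thesis .
qed

text \<open>
  Scaling replaces the divergence theorem: the integral of $W(t x)$ equals $t^{-n}$ times that of $W$,
  and differentiating both sides at $t = 1$ gives the identity.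
\<close>

lemma integral_radial_derivative:
  fixes W :: "'a::euclidean_space \<Rightarrow> real"
  assumes W: "\<And>x. GDERIV W x :> G x" and G: "continuous_on UNIV G"
    and K: "compact K" "\<And>x. x \<notin> K \<Longrightarrow> W x = 0"
  shows "(LINT x|lborel. x \<bullet> G x) = - real DIM('a) * (LINT x|lborel. W x)"
proof -
  let ?n = "real DIM('a)"
  obtain c where c: "K \<subseteq> cbox (- c) c"
    using bounded_subset_cbox_symmetric[OF compact_imp_bounded[OF K(1)]] by auto
  \<comment> \<open>Large enough to contain the support of all the rescaled functions with $t \<ge> 1/2$.\<close>
  let ?Q = "cbox (- 2 *\<^sub>R c) (2 *\<^sub>R c)"
  let ?U = "{1/2..2::real}"
  have contW: "continuous_on UNIV W" by (rule GDERIV_imp_continuous_on) (rule W)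
  have G0: "G x = 0" if "x \<notin> K" for x
    using gradient_zero_outside[OF W K that] .
  define i where "i = integral (cbox (-c) c) W"
  have scaled: "((\<lambda>x. W (t *\<^sub>R x)) has_integral i / t ^ DIM('a)) ?Q" if t: "t \<in> ?U" for t
  proof (rule has_integral_on_superset)
    have "(W has_integral i) (cbox (-c) c)"
      unfolding i_def by (intro integrable_integral integrable_continuous continuous_on_subset[OF contW]) auto
    from has_integral_affinity'[OF this, of t 0] t
    have "((\<lambda>x. W (t *\<^sub>R x)) has_integral (i /\<^sub>R t ^ DIM('a))) (cbox (- (c /\<^sub>R t)) (c /\<^sub>R t))"
      by (simp only: diff_zero add_0_right scaleR_minus_right) simp
    then show "((\<lambda>x. W (t *\<^sub>R x)) has_integral i / t ^ DIM('a)) (cbox (- (c /\<^sub>R t)) (c /\<^sub>R t))"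
      by (simp only: real_scaleR_def divide_inverse mult.commute[of i])
    show "W (t *\<^sub>R x) = 0" if x: "x \<notin> cbox (- (c /\<^sub>R t)) (c /\<^sub>R t)" for x
    proof (rule K(2), rule notI)
      assume "t *\<^sub>R x \<in> K"
      with c have "t *\<^sub>R x \<in> cbox (-c) c" by auto
      then have tx: "- (c \<bullet> b) \<le> t * (x \<bullet> b)" "t * (x \<bullet> b) \<le> c \<bullet> b" if "b \<in> Basis" for b
        using that by (auto simp: mem_box)
      have "x \<in> cbox (- (c /\<^sub>R t)) (c /\<^sub>R t)"
        unfolding mem_box
      proof
        fix b :: 'a assume "b \<in> Basis"
        moreover have "t > 0" using t by simp
        ultimately have "- (c \<bullet> b) / t \<le> x \<bullet> b" "x \<bullet> b \<le> (c \<bullet> b) / t"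
          using tx[of b] by (simp_all only: pos_divide_le_eq pos_le_divide_eq mult.commute[of _ t])
        then show "- (c /\<^sub>R t) \<bullet> b \<le> x \<bullet> b \<and> x \<bullet> b \<le> (c /\<^sub>R t) \<bullet> b"
          by (simp add: divide_inverse_commute)
      qed
      with x show False by simp
    qed
    show "cbox (- (c /\<^sub>R t)) (c /\<^sub>R t) \<subseteq> ?Q"
    proof
      fix x assume x: "x \<in> cbox (- (c /\<^sub>R t)) (c /\<^sub>R t)"
      show "x \<in> ?Q"
        unfolding mem_box
      proof
        fix b :: 'a assume b: "b \<in> Basis"
        from x b have x: "- (c \<bullet> b / t) \<le> x \<bullet> b" "x \<bullet> b \<le> c \<bullet> b / t"
          by (auto simp: mem_box divide_inverse_commute)
        then have "c \<bullet> b / t \<ge> 0" by linarith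
        then have "c \<bullet> b \<ge> 0" using t by (auto simp: zero_le_divide_iff)
        then have "c \<bullet> b / t \<le> 2 * (c \<bullet> b)"
          using t mult_left_mono[of "1" "2 * t" "c \<bullet> b"] by (simp add: divide_le_eq)
        with x show "(- 2 *\<^sub>R c) \<bullet> b \<le> x \<bullet> b \<and> x \<bullet> b \<le> (2 *\<^sub>R c) \<bullet> b"
          by simp
      qed
    qed
  qed
  have deriv: "((\<lambda>t. integral ?Q (\<lambda>x. W (t *\<^sub>R x))) has_vector_derivative integral ?Q (\<lambda>x. G (1 *\<^sub>R x) \<bullet> x)) (at 1 within ?U)"
  proof (rule leibniz_rule_vector_derivative)
    show "((\<lambda>t. W (t *\<^sub>R x)) has_vector_derivative G (t *\<^sub>R x) \<bullet> x) (at t within ?U)" for t x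
      using has_derivative_along_segment[of W 0 t x] W by simp
    show "(\<lambda>x. W (t *\<^sub>R x)) integrable_on ?Q" if "t \<in> ?U" for t
      using scaled[OF that] by blast
    show "continuous_on (?U \<times> ?Q) (\<lambda>(t, x). G (t *\<^sub>R x) \<bullet> x)"
      unfolding split_beta by (intro continuous_intros continuous_on_compose2[OF G]) auto
  qed auto
  have "((\<lambda>t. integral ?Q (\<lambda>x. W (t *\<^sub>R x))) has_real_derivative - ?n * i) (at 1 within ?U)"
  proof (rule DERIV_cong[OF has_field_derivative_transform_within[where f = "\<lambda>t. i / t ^ DIM('a)" and d = 1]])
    show "((\<lambda>t. i / t ^ DIM('a)) has_real_derivative - ?n * i) (at 1 within ?U)"
      by (auto intro!: derivative_eq_intros)
    show "i / t ^ DIM('a) = integral ?Q (\<lambda>x. W (t *\<^sub>R x))" if "t \<in> ?U" for t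
      using scaled[OF that] by (simp add: integral_unique)
  qed auto
  then have "((\<lambda>t. integral ?Q (\<lambda>x. W (t *\<^sub>R x))) has_vector_derivative - ?n * i) (at 1)"
    "((\<lambda>t. integral ?Q (\<lambda>x. W (t *\<^sub>R x))) has_vector_derivative integral ?Q (\<lambda>x. G x \<bullet> x)) (at 1)"
    using deriv by (simp_all add: at_within_Icc_at has_real_derivative_iff_has_vector_derivative)
  then have *: "integral ?Q (\<lambda>x. G x \<bullet> x) = - ?n * i"
    by (rule vector_derivative_unique_at[symmetric])
  have to_box: "(LINT x|lborel. F x) = integral S F"
    if F: "continuous_on UNIV F" "\<And>x. x \<notin> K \<Longrightarrow> F x = 0" and S: "K \<subseteq> S"
    for F :: "'a \<Rightarrow> real" and S
  proof -
    have "integrable lborel F" by (rule integrable_compact_support[OF F(1) K(1) F(2)])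
    then have "(LINT x|lborel. F x) = integral UNIV F" by (rule integral_lborel[symmetric])
    also have "\<dots> = integral UNIV (\<lambda>x. if x \<in> S then F x else 0)"
      using F(2) S by (intro arg_cong2[where f = integral] refl ext) auto
    also have "\<dots> = integral S F" by (rule integral_restrict_UNIV)
    finally show ?thesis .
  qed
  have "K \<subseteq> ?Q"
  proof
    fix x assume "x \<in> K"
    with c have x: "x \<in> cbox (- c) c" by auto
    show "x \<in> ?Q"
      unfolding mem_box
    proof
      fix b :: 'a assume b: "b \<in> Basis"
      with x have "- (c \<bullet> b) \<le> x \<bullet> b" "x \<bullet> b \<le> c \<bullet> b" by (auto simp: mem_box)
      then show "(- 2 *\<^sub>R c) \<bullet> b \<le> x \<bullet> b \<and> x \<bullet> b \<le> (2 *\<^sub>R c) \<bullet> b" by simp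
    qed
  qed
  then have "(LINT x|lborel. x \<bullet> G x) = integral ?Q (\<lambda>x. x \<bullet> G x)"
    by (intro to_box continuous_intros G) (auto simp: G0)
  also have "\<dots> = - ?n * i"
    using * by (simp add: inner_commute)
  also have "i = (LINT x|lborel. W x)"
    unfolding i_def by (rule to_box[symmetric]) (use contW K c in auto)
  finally show ?thesis .
qed

section \<open>Hardy's inequality with a remainder\<close>

lemma continuous_on_punctured_support:
  fixes F :: "'a::real_normed_vector \<Rightarrow> 'b::real_normed_vector"
  assumes "continuous_on (- {0}) F" "compact K" "0 \<notin> K" "\<And>x. x \<notin> K \<Longrightarrow> F x = 0"
  shows "continuous_on UNIV F"
proof -
  have "continuous_on (- K) F"
    using assms(4) by (auto intro: continuous_on_eq[where f = "\<lambda>_. 0"])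
  moreover have "open (- K)" using assms(2) by (simp add: compact_imp_closed open_Compl)
  ultimately have "continuous_on (- {0} \<union> - K) F"
    using assms(1) by (intro continuous_on_open_Un) auto
  moreover have "- {0} \<union> - K = UNIV" using assms(3) by auto
  ultimately show ?thesis by simp
qed

text \<open>
  Continuously differentiable functions with compact support away from the origin, together with their
  gradients. All singular weights $|x|^r$ are harmless for them: a product with such a function stays
  continuous, since it vanishes near the origin.
\<close>

locale punctured_C1 =
  fixes u :: "'a::euclidean_space \<Rightarrow> real" and g :: "'a \<Rightarrow> 'a" and K :: "'a set" and p :: real
  assumes compact_K: "compact K" and zero_notin_K: "0 \<notin> K"
    and gderiv: "\<And>x. GDERIV u x :> g x" and cont_g: "continuous_on UNIV g"
    and u_zero: "\<And>x. x \<notin> K \<Longrightarrow> u x = 0"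
    and p_gt_dim: "p > real DIM('a)"
begin

definition H :: real where "H = (p - real DIM('a)) / p"

abbreviation quotient :: "'a \<Rightarrow> real" where
  "quotient x \<equiv> \<bar>u x\<bar> powr p / norm x powr p"

definition hardy :: real where
  "hardy = (LINT x|lborel. norm (g x) powr p) - H powr p * (LINT x|lborel. quotient x)"

text \<open>
  The part of the gradient that is missed by treating \<open>u\<close> as a multiple of $|x|^H$; away from the
  origin it is $|x|^H$ times the gradient of $|x|^{-H} u$.
\<close>

definition remainder :: "'a \<Rightarrow> 'a" where
  "remainder x = g x - (H * u x / (norm x)\<^sup>2) *\<^sub>R x"

lemma p_gt_1: "p > 1"
  using p_gt_dim DIM_ge_Suc0[where 'a='a] by linarith

lemma H_pos: "0 < H"
  using p_gt_1 p_gt_dim by (auto simp: H_def)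

lemma H_eq: "1 - real DIM('a) / p = H"
  using p_gt_1 by (auto simp: H_def field_simps)

lemma g_zero: "x \<notin> K \<Longrightarrow> g x = 0"
  using gradient_zero_outside[OF gderiv compact_K u_zero] by blast

lemma cont_u: "continuous_on S u"
  using GDERIV_imp_continuous_on[of UNIV, OF gderiv] by (rule continuous_on_subset) simp

lemma closed_K: "closed K"
  using compact_K by (rule compact_imp_closed)

lemma u_zero_origin [simp]: "u 0 = 0" "g 0 = 0"
  using u_zero g_zero zero_notin_K by auto

lemma remainder_zero: "x \<notin> K \<Longrightarrow> remainder x = 0"
  by (simp add: remainder_def u_zero g_zero)

lemmas cont_via_K = continuous_on_punctured_support[OF _ compact_K zero_notin_K]

lemma cont_remainder: "continuous_on UNIV remainder"
proof (rule cont_via_K)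
  show "continuous_on (- {0}) remainder"
    unfolding remainder_def
    by (intro continuous_intros cont_u continuous_on_subset[OF cont_g]) auto
qed (simp add: remainder_zero)

lemma cont_norm_powr: 
  fixes F :: "'b::topological_space \<Rightarrow> 'c::real_normed_vector"
  shows "continuous_on S F \<Longrightarrow> continuous_on S (\<lambda>x. norm (F x) powr p)"
  using p_gt_1 by (intro continuous_on_powr' continuous_intros) auto

lemma cont_abs_powr: "continuous_on S (\<lambda>x. \<bar>u x\<bar> powr p)"
  using cont_norm_powr[OF cont_u] by simp

lemma cont_powr_norm: "continuous_on (- {0}) (\<lambda>x::'a. norm x powr r)"
  by (intro continuous_on_powr continuous_intros) auto

lemma cont_quotient: "continuous_on UNIV quotient"
proof (rule cont_via_K)
  show "continuous_on (- {0}) quotient"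
    by (intro continuous_on_divide cont_abs_powr cont_powr_norm) auto
qed (use p_gt_1 in \<open>simp add: u_zero\<close>)

lemma integrable_g: "integrable lborel (\<lambda>x. norm (g x) powr p)"
  by (rule integrable_compact_support[OF cont_norm_powr[OF cont_g] compact_K])
    (use p_gt_1 in \<open>simp add: g_zero\<close>)

lemma integrable_quotient: "integrable lborel quotient"
  by (rule integrable_compact_support[OF cont_quotient compact_K])
    (use p_gt_1 in \<open>simp add: u_zero\<close>)

lemma integrable_remainder: "integrable lborel (\<lambda>x. norm (remainder x) powr p)"
  by (rule integrable_compact_support[OF cont_norm_powr[OF cont_remainder] compact_K])
    (use p_gt_1 in \<open>simp add: remainder_zero\<close>)

abbreviation radial :: "'a \<Rightarrow> real" where
  "radial x \<equiv> \<bar>u x\<bar> powr (p - 2) * u x * (x \<bullet> g x) / norm x powr p"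

lemma GDERIV_norm_powr:
  fixes x :: 'a
  assumes "x \<noteq> 0"
  shows "GDERIV (\<lambda>x. norm x powr r) x :> (r * norm x powr (r - 1)) *\<^sub>R sgn x"
  using assms by (intro GDERIV_DERIV_compose[OF GDERIV_norm has_real_derivative_powr]) auto

text \<open>
  The identity behind Hardy's inequality, obtained from \<open>integral_radial_derivative\<close> with
  $W = |u|^p/|x|^p$, whose radial derivative is $p$ times the difference of \<open>radial\<close> and $W$.
\<close>

lemma integral_radial:
  shows "integrable lborel radial" "(LINT x|lborel. radial x) = H * (LINT x|lborel. quotient x)"
proof -
  define D where "D x = (\<bar>u x\<bar> powr p * (- p * norm x powr (- p - 1))) *\<^sub>R sgn x
      + (norm x powr (- p) * (p * (\<bar>u x\<bar> powr (p - 2) * u x))) *\<^sub>R g x" for x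
  have D_zero: "D x = 0" if "x \<notin> K" for x
    using that p_gt_1 by (simp add: D_def u_zero g_zero)
  have deriv: "GDERIV quotient x :> D x" for x
  proof (cases "x = 0")
    case True
    have "GDERIV quotient x :> 0"
      by (rule GDERIV_zero_outside[OF closed_K]) (use True zero_notin_K p_gt_1 in \<open>simp_all add: u_zero\<close>)
    then show ?thesis using True D_zero zero_notin_K by simp
  next
    case False
    have "GDERIV (\<lambda>x. \<bar>u x\<bar> powr p * norm x powr (- p)) x :> D x"
      by (rule GDERIV_subst[OF GDERIV_mult[OF GDERIV_DERIV_compose[OF gderiv
            has_real_derivative_abs_powr[OF p_gt_1]] GDERIV_norm_powr[OF False]]])
        (simp add: D_def)
    then show ?thesis by (simp add: powr_minus divide_inverse)
  qed
  have cont_D: "continuous_on UNIV D"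
  proof (rule cont_via_K)
    have "continuous_on (- {0}) (\<lambda>x. \<bar>u x\<bar> powr (p - 2) * u x)"
      by (rule continuous_on_compose2[OF continuous_on_signed_powr[OF p_gt_1] cont_u]) auto
    then have "continuous_on (- {0}) (\<lambda>x. p * (\<bar>u x\<bar> powr (p - 2) * u x))"
      by (rule continuous_on_mult_left)
    moreover have "continuous_on (- {0}) (\<lambda>x::'a. - p * norm x powr (- p - 1))"
      by (rule continuous_on_mult_left) (rule cont_powr_norm)
    moreover have "continuous_on (- {0}) (\<lambda>x::'a. sgn x)"
      by (intro continuous_on_sgn continuous_intros) auto
    ultimately show "continuous_on (- {0}) D"
      unfolding D_def
      by (intro continuous_on_add continuous_on_scaleR continuous_on_mult[where f = "\<lambda>x. \<bar>u x\<bar> powr p"]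
         continuous_on_mult[where f = "\<lambda>x. norm x powr (- p)"] cont_abs_powr cont_powr_norm
         continuous_on_subset[OF cont_g]) auto
  qed (rule D_zero)
  have eq: "x \<bullet> D x = p * radial x - p * quotient x" for x
  proof (cases "x = 0")
    case False
    have "norm x powr (- p - 1) * (x \<bullet> sgn x) = norm x powr (- p)"
      using False by (simp add: sgn_div_norm powr_diff dot_square_norm power2_eq_square)
    then have "\<bar>u x\<bar> powr p * (p * (norm x powr (- p - 1) * (x \<bullet> sgn x))) = p * quotient x"
      by (simp add: powr_minus divide_inverse)
    then show ?thesis
      by (simp add: D_def inner_add_right powr_minus divide_inverse algebra_simps) metis
  qed simp
  have radial_eq: "radial x = (x \<bullet> D x) / p + quotient x" for x
    using p_gt_1 by (simp add: eq field_simps)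
  have int_D: "integrable lborel (\<lambda>x. x \<bullet> D x)"
    by (rule integrable_compact_support[OF _ compact_K])
      (auto intro!: continuous_intros cont_D simp: D_zero)
  show int: "integrable lborel radial"
    unfolding radial_eq using int_D integrable_quotient by simp
  have "(LINT x|lborel. x \<bullet> D x) = - real DIM('a) * (LINT x|lborel. quotient x)"
    by (rule integral_radial_derivative[OF deriv cont_D compact_K]) (use p_gt_1 in \<open>simp add: u_zero\<close>)
  then have "(LINT x|lborel. radial x) = (- real DIM('a) * (LINT x|lborel. quotient x)) / p + (LINT x|lborel. quotient x)"
    unfolding radial_eq using int_D integrable_quotient by simp
  also have "\<dots> = H * (LINT x|lborel. quotient x)"
    using p_gt_1 by (simp add: H_def field_simps)
  finally show "(LINT x|lborel. radial x) = H * (LINT x|lborel. quotient x)" .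
qed

text \<open>
  Apply uniform convexity with base point $a = H u x/|x|^2$, the gradient of $|x|^H$ times $v$. Then
  $|a|^p = H^p |u|^p/|x|^p$, and by \<open>integral_radial\<close> the linear term integrates to $p$ times the integral
  of $|a|^p$, so that $1 - p + p = 1$ copy of the Hardy term remains.
\<close>

theorem remainder_le_hardy:
  assumes "p > 2"
  shows "2 powr (1 - p) * (LINT x|lborel. norm (remainder x) powr p) \<le> hardy"
proof -
  have pointwise: "(1 - p) * (H powr p * quotient x) + p * (H powr (p - 1) * radial x)
      + 2 powr (1 - p) * norm (remainder x) powr p \<le> norm (g x) powr p" for x
  proof (cases "x = 0")
    case False
    define a where "a = (H * u x / (norm x)\<^sup>2) *\<^sub>R x"
    have na: "norm a = H * \<bar>u x\<bar> / norm x"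
      using H_pos False by (simp add: a_def power2_eq_square abs_mult)
    have 1: "norm a powr p = H powr p * quotient x"
      using H_pos by (simp add: na powr_mult powr_divide)
    have "norm a powr (p - 2) * (a \<bullet> g x)
        = (H powr (p - 2) * \<bar>u x\<bar> powr (p - 2) / norm x powr (p - 2)) * (H * u x / (norm x)\<^sup>2 * (x \<bullet> g x))"
      using H_pos by (simp add: na powr_mult powr_divide) (simp add: a_def)
    also have "\<dots> = (H powr (p - 2) * H) * (\<bar>u x\<bar> powr (p - 2) * u x * (x \<bullet> g x)) / (norm x powr (p - 2) * (norm x)\<^sup>2)"
      by simp
    also have "norm x powr (p - 2) * (norm x)\<^sup>2 = norm x powr p"
      using powr_add[of "norm x" "p - 2" 2] False by simp
    also have "H powr (p - 2) * H = H powr (p - 1)"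
      using powr_add[of H "p - 2" 1] H_pos by simp
    finally have 2: "norm a powr (p - 2) * (a \<bullet> g x) = H powr (p - 1) * radial x"
      by simp
    have "remainder x = g x - a" by (simp add: remainder_def a_def)
    then show ?thesis
      using norm_powr_uniformly_convex[OF assms, of a "g x"] unfolding 1 2 by simp
  qed (simp add: remainder_def)
  have "(LINT x|lborel. (1 - p) * (H powr p * quotient x) + p * (H powr (p - 1) * radial x)
      + 2 powr (1 - p) * norm (remainder x) powr p) \<le> (LINT x|lborel. norm (g x) powr p)"
    using integral_radial(1) integrable_quotient integrable_remainder integrable_g
    by (intro integral_mono pointwise Bochner_Integration.integrable_add integrable_mult_right)
  also have "(LINT x|lborel. (1 - p) * (H powr p * quotient x) + p * (H powr (p - 1) * radial x)
      + 2 powr (1 - p) * norm (remainder x) powr p)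
     = (1 - p) * (H powr p * (LINT x|lborel. quotient x)) + p * (H powr (p - 1) * (LINT x|lborel. radial x))
      + 2 powr (1 - p) * (LINT x|lborel. norm (remainder x) powr p)"
    using integral_radial(1) integrable_quotient integrable_remainder
    by (simp only: Bochner_Integration.integral_add Bochner_Integration.integrable_add
        integrable_mult_right integral_mult_right_zero)
  also have "H powr (p - 1) * (LINT x|lborel. radial x) = H powr p * (LINT x|lborel. quotient x)"
    using powr_add[of H "p - 1" 1] H_pos by (simp add: integral_radial(2))
  finally show ?thesis
    by (simp add: hardy_def algebra_simps)
qed

end

section \<open>The weighted Morrey estimate\<close>

lemma norm_diff_le_cube:
  fixes x z w :: "'a::euclidean_space"
  assumes "z \<in> cbox (x - h *\<^sub>R One) (x + h *\<^sub>R One)" "w \<in> cbox (x - h *\<^sub>R One) (x + h *\<^sub>R One)"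
  shows "norm (z - w) \<le> 2 * real DIM('a) * h"
proof -
  have "norm (z - w) \<le> (\<Sum>i\<in>Basis. \<bar>(z - w) \<bullet> i\<bar>)" by (rule norm_le_l1)
  also have "\<dots> \<le> (\<Sum>i\<in>(Basis::'a set). 2 * h)"
  proof (rule sum_mono)
    fix i :: 'a assume "i \<in> Basis"
    then have "x \<bullet> i - h \<le> z \<bullet> i" "z \<bullet> i \<le> x \<bullet> i + h" "x \<bullet> i - h \<le> w \<bullet> i" "w \<bullet> i \<le> x \<bullet> i + h"
      using assms by (auto simp: mem_box inner_simps)
    then show "\<bar>(z - w) \<bullet> i\<bar> \<le> 2 * h" by (simp add: inner_diff_left abs_le_iff)
  qed
  finally show ?thesis by (simp add: mult.assoc)
qed

lemma norm_center_diff_le_cube: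
  fixes x z :: "'a::euclidean_space"
  assumes "z \<in> cbox (x - h *\<^sub>R One) (x + h *\<^sub>R One)"
  shows "norm (z - x) \<le> real DIM('a) * h"
proof -
  have "norm (z - x) \<le> (\<Sum>i\<in>Basis. \<bar>(z - x) \<bullet> i\<bar>)" by (rule norm_le_l1)
  also have "\<dots> \<le> (\<Sum>i\<in>(Basis::'a set). h)"
  proof (rule sum_mono)
    fix i :: 'a assume "i \<in> Basis"
    then have "x \<bullet> i - h \<le> z \<bullet> i" "z \<bullet> i \<le> x \<bullet> i + h"
      using assms by (auto simp: mem_box inner_simps)
    then show "\<bar>(z - x) \<bullet> i\<bar> \<le> h" by (simp add: inner_diff_left abs_le_iff)
  qed
  finally show ?thesis by simp
qed

lemma measure_cube:
  fixes x :: "'a::euclidean_space"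
  assumes "h \<ge> 0"
  shows "measure lborel (cbox (x - h *\<^sub>R One) (x + h *\<^sub>R One)) = (2 * h) ^ DIM('a)"
proof -
  have "(\<Prod>b\<in>(Basis::'a set). (x + h *\<^sub>R One - (x - h *\<^sub>R One)) \<bullet> b) = (\<Prod>b\<in>(Basis::'a set). 2 * h)"
    by (intro prod.cong refl) (simp add: inner_simps)
  then show ?thesis
    using assms by (subst measure_lborel_cbox) (auto simp: inner_simps)
qed

context punctured_C1
begin

text \<open>
  The quotient of \<open>u\<close> by the virtual extremal of Hardy's inequality.
\<close>

definition v :: "'a \<Rightarrow> real" where "v x = norm x powr (- H) * u x"

definition remainder_norm :: real where "remainder_norm = (LINT x|lborel. norm (remainder x) powr p) powr (1 / p)"

lemma remainder_norm_nonneg: "0 \<le> remainder_norm" by (simp add: remainder_norm_def)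

lemma GDERIV_v: "GDERIV v x :> norm x powr (- H) *\<^sub>R remainder x"
proof (cases "x = 0")
  case True
  have "GDERIV v x :> 0"
    by (rule GDERIV_zero_outside[OF closed_K]) (use True zero_notin_K in \<open>simp_all add: u_zero v_def\<close>)
  then show ?thesis using True by (simp add: remainder_def)
next
  case False
  show ?thesis
    unfolding v_def
  proof (rule GDERIV_subst[OF GDERIV_mult[OF GDERIV_norm_powr[OF False] gderiv]])
    have "(- H * norm x powr (- H - 1)) *\<^sub>R sgn x = (- (norm x powr (- H)) * H / (norm x)\<^sup>2) *\<^sub>R x"
      using False by (simp add: sgn_div_norm powr_diff power2_eq_square field_simps)
    then show "norm x powr (- H) *\<^sub>R g x + u x *\<^sub>R (- H * norm x powr (- H - 1)) *\<^sub>R sgn x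
        = norm x powr (- H) *\<^sub>R remainder x"
      by (simp add: remainder_def scaleR_diff_right mult_ac)
  qed
qed

lemma cont_grad_v: "continuous_on UNIV (\<lambda>x. norm x powr (- H) *\<^sub>R remainder x)"
  by (rule cont_via_K)
    (auto intro!: continuous_on_scaleR cont_powr_norm continuous_on_subset[OF cont_remainder]
      simp: remainder_zero)

text \<open>
  On a cube around $x$ with half side $h \<le> |x|/(2n)$ every point has norm at least $|x|/2$. The gradient
  of \<open>v\<close> is the remainder divided by $|x|^H$, so the weight can be taken out of Morrey's inequality there;
  it cancels against the factor $|x|^H$ on the left and only the power $h^{1 - n/p} = h^H$ is left.
\<close>

lemma oscillation_v:
  assumes x: "x \<noteq> 0" and h: "0 < h" "2 * real DIM('a) * h \<le> norm x"
    and y: "y \<in> cbox (x - h *\<^sub>R One) (x + h *\<^sub>R One)"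
  shows "norm x powr H * \<bar>v x - v y\<bar> \<le> 4 * real DIM('a) / H * (4 * h) powr H * remainder_norm"
proof -
  let ?Q = "cbox (x - h *\<^sub>R One) (x + h *\<^sub>R One)" and ?n = "real DIM('a)"
  let ?g = "\<lambda>z. norm z powr (- H) *\<^sub>R remainder z"
  define B where "B = (LINT x|lborel. norm (remainder x) powr p)"
  have B: "B \<ge> 0" by (simp add: B_def)
  have xQ: "x \<in> ?Q" using h by (auto simp: mem_box inner_simps)
  have far: "norm x / 2 \<le> norm z" if "z \<in> ?Q" for z
    using norm_center_diff_le_cube[OF that] norm_triangle_ineq2[of x z] h(2)
    by (simp add: norm_minus_commute)
  have "integral ?Q (\<lambda>z. norm (?g z) powr p) \<le> integral ?Q (\<lambda>z. (norm x / 2) powr (- H * p) * norm (remainder z) powr p)"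
  proof (rule integral_le)
    show "(\<lambda>z. norm (?g z) powr p) integrable_on ?Q"
      by (intro integrable_continuous cont_norm_powr continuous_on_subset[OF cont_grad_v]) auto
    show "(\<lambda>z. (norm x / 2) powr (- H * p) * norm (remainder z) powr p) integrable_on ?Q"
      by (intro integrable_continuous continuous_on_mult_left cont_norm_powr continuous_on_subset[OF cont_remainder]) auto
    fix z assume "z \<in> ?Q"
    have "norm z powr (- H * p) \<le> (norm x / 2) powr (- H * p)"
      using far[OF \<open>z \<in> ?Q\<close>] x H_pos p_gt_1 by (intro powr_mono2') auto
    then show "norm (?g z) powr p \<le> (norm x / 2) powr (- H * p) * norm (remainder z) powr p"
      by (simp add: powr_mult powr_powr mult_right_mono)
  qed
  also have "\<dots> = (norm x / 2) powr (- H * p) * integral ?Q (\<lambda>z. norm (remainder z) powr p)"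
    by simp
  also have "integral ?Q (\<lambda>z. norm (remainder z) powr p) \<le> integral UNIV (\<lambda>z. norm (remainder z) powr p)"
    by (intro integral_subset_le integrable_on_lborel[OF integrable_remainder] integrable_continuous
        cont_norm_powr continuous_on_subset[OF cont_remainder]) auto
  also have "\<dots> = B"
    unfolding B_def by (rule integral_lborel[OF integrable_remainder])
  finally have "integral ?Q (\<lambda>z. norm (?g z) powr p) \<le> (norm x / 2) powr (- H * p) * B"
    by (simp add: mult_left_mono)
  then have "integral ?Q (\<lambda>z. norm (?g z) powr p) / measure lborel ?Q
      \<le> (norm x / 2) powr (- H * p) * B / (2 * h) powr ?n"
    using h by (simp add: measure_cube powr_realpow divide_right_mono)
  then have "(integral ?Q (\<lambda>z. norm (?g z) powr p) / measure lborel ?Q) powr (1 / p)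
      \<le> ((norm x / 2) powr (- H * p) * B / (2 * h) powr ?n) powr (1 / p)"
  proof (rule powr_mono2[rotated 2])
    have "0 \<le> integral ?Q (\<lambda>z. norm (?g z) powr p)"
      by (intro integral_nonneg integrable_continuous cont_norm_powr continuous_on_subset[OF cont_grad_v]) auto
    then show "0 \<le> integral ?Q (\<lambda>z. norm (?g z) powr p) / measure lborel ?Q"
      by (intro divide_nonneg_nonneg) auto
  qed (use p_gt_1 in auto)
  also have "\<dots> = (norm x / 2) powr (- H * p * (1 / p)) * B powr (1 / p) / (2 * h) powr (?n * (1 / p))"
    by (simp only: powr_mult powr_divide powr_powr)
  also have "\<dots> = (norm x / 2) powr (- H) * remainder_norm * (2 * h) powr (- (?n / p))"
  proof -
    have "- H * p * (1 / p) = - H" "?n * (1 / p) = ?n / p" using p_gt_1 by auto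
    then show ?thesis
      by (simp only: remainder_norm_def B_def powr_minus_divide[of "2 * h"]) simp
  qed
  finally have G: "(integral ?Q (\<lambda>z. norm (?g z) powr p) / measure lborel ?Q) powr (1 / p)
      \<le> (norm x / 2) powr (- H) * remainder_norm * (2 * h) powr (- (?n / p))" .
  have "\<bar>v x - v y\<bar> \<le> 4 * (2 * ?n * h) / (1 - ?n / p) *
      (integral ?Q (\<lambda>z. norm (?g z) powr p) / measure lborel ?Q) powr (1 / p)"
    by (rule Morrey_cube[OF GDERIV_v cont_grad_v p_gt_dim xQ y])
      (use h norm_diff_le_cube measure_cube[of h x] in auto)
  also have "\<dots> \<le> 4 * (2 * ?n * h) / (1 - ?n / p) * ((norm x / 2) powr (- H) * remainder_norm * (2 * h) powr (- (?n / p)))"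
    using G h H_pos unfolding H_eq by (intro mult_left_mono) auto
  also have "\<dots> = 4 * ?n / H * (norm x / 2) powr (- H) * remainder_norm * (2 * h) powr H"
  proof -
    have "2 * h * (2 * h) powr (- (?n / p)) = (2 * h) powr H"
      using h powr_add[of "2 * h" 1 "- (?n / p)"] by (simp flip: H_eq)
    then have "4 * ?n / H * ((norm x / 2) powr (- H) * remainder_norm) * (2 * h * (2 * h) powr (- (?n / p)))
        = 4 * ?n / H * ((norm x / 2) powr (- H) * remainder_norm) * (2 * h) powr H" by simp
    then show ?thesis unfolding H_eq by (simp add: mult_ac)
  qed
  finally have "norm x powr H * \<bar>v x - v y\<bar> \<le> norm x powr H * (4 * ?n / H * (norm x / 2) powr (- H) * remainder_norm * (2 * h) powr H)"
    by (intro mult_left_mono) auto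
  also have "\<dots> = 4 * ?n / H * (norm x powr H * (norm x / 2) powr (- H) * (2 * h) powr H) * remainder_norm"
    by simp
  also have "norm x powr H * (norm x / 2) powr (- H) * (2 * h) powr H = (4 * h) powr H"
  proof -
    have "(4 * h) powr H = (2 * (2 * h)) powr H" by simp
    also have "\<dots> = 2 powr H * (2 * h) powr H" by (rule powr_mult)
    finally show ?thesis
      using x by (simp add: powr_divide powr_minus field_simps)
  qed
  finally show ?thesis .
qed

lemma abs_u_eq: "\<bar>u x\<bar> = norm x powr H * \<bar>v x\<bar>"
  by (cases "x = 0") (auto simp: v_def abs_mult powr_minus)

text \<open>
  The proof shows $|u(x)| \<le> \<kappa>^{-H} S + A$ for any upper bound $S$ of $|u|$. Since $\<kappa>^{-H} < 1$
  and the maximum of $|u|$ is attained, this self-improving estimate bounds the maximum.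
\<close>

theorem sup_le_remainder:
  assumes \<Omega>: "\<Omega> \<in> sets lborel" "emeasure lborel \<Omega> < \<infinity>" "measure lborel \<Omega> > 0"
    and supp: "\<And>x. x \<notin> \<Omega> \<Longrightarrow> u x = 0"
  shows "\<bar>u x\<bar> \<le> 4 * real DIM('a) * 4 powr H / (H * (1 - (1 + 1 / (2 * real DIM('a))) powr (- H)))
           * measure lborel \<Omega> powr (H / real DIM('a)) * remainder_norm"
proof -
  let ?n = "real DIM('a)"
  have n: "?n > 0" by simp
  define \<kappa> where "\<kappa> = 1 + 1 / (2 * ?n)"
  define h where "h = measure lborel \<Omega> powr (1 / ?n)"
  define A where "A = 4 * ?n / H * (4 * h) powr H * remainder_norm"
  have h: "h > 0" using \<Omega> by (simp add: h_def)
  have A: "A \<ge> 0" using H_pos remainder_norm_nonneg by (simp add: A_def)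
  have \<kappa>: "\<kappa> > 1" using n by (simp add: \<kappa>_def)
  have \<kappa>H: "\<kappa> powr (- H) < 1"
    using \<kappa> H_pos powr_less_mono[of "- H" 0 \<kappa>] by simp
  have step: "\<bar>u x\<bar> \<le> \<kappa> powr (- H) * S + A" if S: "\<And>y. \<bar>u y\<bar> \<le> S" for x S
  proof (cases "x = 0")
    case True
    then show ?thesis using S[of 0] A by simp
  next
    case x: False
    show ?thesis
    proof (cases "2 * ?n * h \<le> norm x")
      case True
      let ?Q = "cbox (x - h *\<^sub>R One) (x + h *\<^sub>R One)"
      \<comment> \<open>The cube has $2^n$ times the measure of \<open>\<Omega>\<close>.\<close>
      have "\<exists>z\<in>?Q. z \<notin> \<Omega>"
      proof (rule ccontr)
        assume "\<not> (\<exists>z\<in>?Q. z \<notin> \<Omega>)"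
        then have "measure lborel ?Q \<le> measure lborel \<Omega>"
          using \<Omega> by (intro measure_mono_fmeasurable) (auto simp: fmeasurable_def)
        moreover have "measure lborel ?Q = 2 ^ DIM('a) * measure lborel \<Omega>"
          using h \<Omega>(3) by (simp add: measure_cube power_mult_distrib h_def flip: powr_realpow) (simp add: powr_powr powr_realpow)
        moreover have "(2::real) ^ DIM('a) > 1" by (intro one_less_power) auto
        ultimately show False using \<Omega>(3) by (simp add: mult_le_cancel_right2)
      qed
      then obtain z where z: "z \<in> ?Q" "u z = 0" using supp by blast
      from oscillation_v[OF x h True z(1)] z(2) have "\<bar>u x\<bar> \<le> A"
        by (simp add: v_def[of z] abs_u_eq A_def)
      then show ?thesis using S[of 0] by (simp add: add_increasing)
    next
      case False
      \<comment> \<open>The largest half side that \<open>oscillation_v\<close> allows; it is less than \<open>h\<close>, and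
        $\<kappa>$ is chosen such that the cube of this size reaches $\<kappa> x$.\<close>
      define k where "k = norm x / (2 * ?n)"
      have k: "k > 0" "2 * ?n * k \<le> norm x" using x n by (auto simp: k_def)
      have "\<kappa> *\<^sub>R x \<in> cbox (x - k *\<^sub>R One) (x + k *\<^sub>R One)"
        unfolding mem_box
      proof
        fix i :: 'a assume i: "i \<in> Basis"
        have "\<bar>x \<bullet> i\<bar> / (2 * ?n) \<le> k"
          unfolding k_def using i by (intro divide_right_mono Basis_le_norm) auto
        then have "\<bar>x \<bullet> i / (2 * ?n)\<bar> \<le> k" by simp
        then have "x \<bullet> i / (2 * ?n) \<le> k" "- k \<le> x \<bullet> i / (2 * ?n)" by linarith+
        moreover have "(\<kappa> *\<^sub>R x) \<bullet> i = x \<bullet> i + x \<bullet> i / (2 * ?n)"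
          by (simp add: \<kappa>_def algebra_simps)
        ultimately show "(x - k *\<^sub>R One) \<bullet> i \<le> (\<kappa> *\<^sub>R x) \<bullet> i \<and> (\<kappa> *\<^sub>R x) \<bullet> i \<le> (x + k *\<^sub>R One) \<bullet> i"
          using i by (simp add: inner_simps)
      qed
      from oscillation_v[OF x k this]
      have "norm x powr H * \<bar>v x - v (\<kappa> *\<^sub>R x)\<bar> \<le> 4 * ?n / H * (4 * k) powr H * remainder_norm" .
      also have "\<dots> \<le> A"
        unfolding A_def using H_pos remainder_norm_nonneg k False n
        by (intro mult_right_mono mult_left_mono powr_mono2) (auto simp: k_def field_simps)
      finally have osc: "norm x powr H * \<bar>v x - v (\<kappa> *\<^sub>R x)\<bar> \<le> A" .
      have "\<bar>u x\<bar> \<le> norm x powr H * (\<bar>v (\<kappa> *\<^sub>R x)\<bar> + \<bar>v x - v (\<kappa> *\<^sub>R x)\<bar>)"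
        unfolding abs_u_eq by (intro mult_left_mono) auto
      also have "\<dots> \<le> norm x powr H * \<bar>v (\<kappa> *\<^sub>R x)\<bar> + A"
        using osc by (simp add: distrib_left)
      also have "norm x powr H * \<bar>v (\<kappa> *\<^sub>R x)\<bar> = \<kappa> powr (- H) * \<bar>u (\<kappa> *\<^sub>R x)\<bar>"
        using \<kappa> by (simp add: abs_u_eq powr_mult powr_minus)
      also have "\<dots> \<le> \<kappa> powr (- H) * S" by (intro mult_left_mono S) simp
      finally show ?thesis by simp
    qed
  qed
  have "\<exists>x0. \<forall>y. \<bar>u y\<bar> \<le> \<bar>u x0\<bar>"
  proof (cases "K = {}")
    case True
    then show ?thesis using u_zero by auto
  next
    case False
    have "continuous_on K (\<lambda>x. \<bar>u x\<bar>)" by (intro continuous_intros cont_u)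
    from continuous_attains_sup[OF compact_K False this]
    obtain x0 where "\<forall>y\<in>K. \<bar>u y\<bar> \<le> \<bar>u x0\<bar>" by auto
    then show ?thesis using u_zero by (metis abs_ge_zero abs_zero)
  qed
  then obtain x0 where x0: "\<And>y. \<bar>u y\<bar> \<le> \<bar>u x0\<bar>" by blast
  have "\<bar>u x0\<bar> * (1 - \<kappa> powr (- H)) \<le> A"
    using step[OF x0, of x0] by (simp add: algebra_simps)
  then have "\<bar>u x0\<bar> \<le> A / (1 - \<kappa> powr (- H))"
    using \<kappa>H by (simp add: pos_le_divide_eq)
  also have "A / (1 - \<kappa> powr (- H)) = 4 * ?n * 4 powr H / (H * (1 - \<kappa> powr (- H))) * h powr H * remainder_norm"
    by (simp add: A_def powr_mult)
  also have "h powr H = measure lborel \<Omega> powr (H / ?n)"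
    by (simp add: h_def powr_powr)
  finally show ?thesis using x0[of x] unfolding \<kappa>_def by linarith
qed

end

section \<open>Dimension one\<close>

text \<open>
  The calibration $\<psi>(t) = H^{p-1} (t^{1-p} - m)$. The tangent inequality at $\<theta> w$ with
  $\<theta>^{p-1} = \<psi>$ bounds $|w'|^p$ from below by the part of $(\<psi> |w|^p)'$ that contains $w'$, up to
  $(p-1) \<theta>^p |w|^p \<le> (p-1) H^p t^{-p} |w|^p$. The other part is $\<psi>' |w|^p = - p H^p t^{-p} |w|^p$, for every
  $m$, and accounts for this error and the Hardy term together.
\<close>

lemma hardy_interval:
  fixes w w' :: "real \<Rightarrow> real"
  assumes p: "p > 1" and w: "\<And>t. DERIV w t :> w' t" and w': "continuous_on UNIV w'"
    and ab: "0 < a" "a \<le> b" and m: "0 \<le> m" "m \<le> b powr (1 - p)"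
  defines "H \<equiv> (p - 1) / p"
  shows "H powr (p - 1) * (b powr (1 - p) - m) * \<bar>w b\<bar> powr p
      - H powr (p - 1) * (a powr (1 - p) - m) * \<bar>w a\<bar> powr p
    \<le> integral {a..b} (\<lambda>t. \<bar>w' t\<bar> powr p - H powr p * (\<bar>w t\<bar> powr p / \<bar>t\<bar> powr p))"
proof -
  have H: "H > 0" using p by (simp add: H_def)
  define c where "c = H powr (p - 1)"
  define \<psi> where "\<psi> t = c * (t powr (1 - p) - m)" for t
  define F' where "F' t = \<psi> t * (p * (\<bar>w t\<bar> powr (p - 2) * w t) * w' t)
      + c * ((1 - p) * t powr (- p)) * \<bar>w t\<bar> powr p" for t
  let ?J = "\<lambda>t. \<bar>w' t\<bar> powr p - H powr p * (\<bar>w t\<bar> powr p / \<bar>t\<bar> powr p)"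
  have contw: "continuous_on S w" for S
    using w by (meson DERIV_isCont continuous_at_imp_continuous_on)
  have "(F' has_integral (\<psi> b * \<bar>w b\<bar> powr p - \<psi> a * \<bar>w a\<bar> powr p)) {a..b}"
  proof (rule fundamental_theorem_of_calculus[OF ab(2)])
    fix t assume t: "t \<in> {a..b}"
    have "((\<lambda>t. \<bar>w t\<bar> powr p) has_real_derivative p * (\<bar>w t\<bar> powr (p - 2) * w t) * w' t) (at t)"
      by (rule DERIV_chain2[OF has_real_derivative_abs_powr[OF p] w])
    moreover have "(\<psi> has_real_derivative c * ((1 - p) * t powr (- p))) (at t)"
      unfolding \<psi>_def using t ab by (auto intro!: derivative_eq_intros)
    ultimately have "((\<lambda>t. \<psi> t * \<bar>w t\<bar> powr p) has_real_derivative F' t) (at t)"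
      unfolding F'_def by (rule DERIV_cong[OF DERIV_mult[rotated]]) (simp add: algebra_simps)
    then show "((\<lambda>t. \<psi> t * \<bar>w t\<bar> powr p) has_vector_derivative F' t) (at t within {a..b})"
      by (simp add: has_real_derivative_iff_has_vector_derivative has_vector_derivative_at_within)
  qed
  moreover have "(?J has_integral integral {a..b} ?J) {a..b}"
  proof (intro integrable_integral integrable_continuous_real continuous_on_diff continuous_on_mult_left
      continuous_on_divide)
    have "continuous_on {a..b} w'" using w' by (rule continuous_on_subset) simp
    then show "continuous_on {a..b} (\<lambda>t. \<bar>w' t\<bar> powr p)" "continuous_on {a..b} (\<lambda>t. \<bar>w t\<bar> powr p)"
      using p contw by (intro continuous_on_powr' continuous_on_rabs continuous_on_const ballI; simp)+
    show "continuous_on {a..b} (\<lambda>t. \<bar>t\<bar> powr p)"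
      using ab by (auto intro!: continuous_intros)
  qed (use ab in auto)
  moreover have "F' t \<le> ?J t" if t: "t \<in> {a..b}" for t
  proof -
    have t0: "t > 0" using t ab by simp
    have "b powr (1 - p) \<le> t powr (1 - p)"
      using t t0 p by (intro powr_mono2') auto
    then have \<psi>: "0 \<le> \<psi> t" "\<psi> t \<le> c * t powr (1 - p)"
      using m by (auto simp: \<psi>_def c_def intro!: mult_left_mono)
    define \<theta> where "\<theta> = \<psi> t powr (1 / (p - 1))"
    have \<theta>: "\<theta> \<ge> 0" by (simp add: \<theta>_def)
    have \<theta>1: "\<theta> powr (p - 1) = \<psi> t"
      using \<psi>(1) p by (simp add: \<theta>_def powr_powr)
    have "\<theta> powr p = \<psi> t powr (p / (p - 1))"
      by (simp add: \<theta>_def powr_powr)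
    also have "\<dots> \<le> (c * t powr (1 - p)) powr (p / (p - 1))"
      using \<psi> p by (intro powr_mono2) auto
    also have "\<dots> = H powr p * t powr (- p)"
    proof -
      have "(1 - p) * (p / (p - 1)) = - p" "(p - 1) * (p / (p - 1)) = p"
        using p by (auto simp: field_simps)
      then show ?thesis by (simp only: c_def powr_mult powr_powr)
    qed
    finally have \<theta>p: "\<theta> powr p \<le> H powr p * t powr (- p)" .
    have "p * (norm (\<theta> * w t) powr (p - 2) * ((\<theta> * w t) \<bullet> w' t))
        \<le> norm (w' t) powr p + (p - 1) * norm (\<theta> * w t) powr p"
      by (rule norm_powr_tangent) fact
    also have "norm (\<theta> * w t) powr p = \<theta> powr p * \<bar>w t\<bar> powr p"
      using \<theta> by (simp add: abs_mult powr_mult)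
    also have "norm (\<theta> * w t) powr (p - 2) * ((\<theta> * w t) \<bullet> w' t)
        = (\<theta> powr (p - 2) * \<theta>) * (\<bar>w t\<bar> powr (p - 2) * w t * w' t)"
      using \<theta> by (simp add: abs_mult powr_mult)
    also have "\<theta> powr (p - 2) * \<theta> = \<psi> t"
      using powr_add[of \<theta> "p - 2" 1] \<theta> by (simp add: \<theta>1)
    finally have "p * (\<psi> t * (\<bar>w t\<bar> powr (p - 2) * w t * w' t))
        \<le> \<bar>w' t\<bar> powr p + (p - 1) * (\<theta> powr p * \<bar>w t\<bar> powr p)" by simp
    also have "\<dots> \<le> \<bar>w' t\<bar> powr p + (p - 1) * (H powr p * t powr (- p) * \<bar>w t\<bar> powr p)"
      using p by (intro add_left_mono mult_left_mono mult_right_mono \<theta>p) auto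
    finally have main: "p * (\<psi> t * (\<bar>w t\<bar> powr (p - 2) * w t * w' t))
        \<le> \<bar>w' t\<bar> powr p + (p - 1) * (H powr p * t powr (- p) * \<bar>w t\<bar> powr p)" .
    have "c * (p - 1) = p * H powr p"
    proof -
      have "H powr p = c * H"
        using powr_add[of H "p - 1" 1] H by (simp add: c_def)
      then show ?thesis using p by (simp add: H_def)
    qed
    then have "c * ((1 - p) * t powr (- p)) * \<bar>w t\<bar> powr p = - (p * H powr p) * t powr (- p) * \<bar>w t\<bar> powr p"
      by (metis (no_types, opaque_lifting) minus_diff_eq minus_mult_left minus_mult_right mult.assoc)
    moreover have "\<bar>w t\<bar> powr p / \<bar>t\<bar> powr p = t powr (- p) * \<bar>w t\<bar> powr p"
      using t0 by (simp add: powr_minus divide_inverse)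
    ultimately show ?thesis
      using main unfolding F'_def by (simp add: algebra_simps)
  qed
  ultimately have "\<psi> b * \<bar>w b\<bar> powr p - \<psi> a * \<bar>w a\<bar> powr p \<le> integral {a..b} ?J"
    by (rule has_integral_le)
  then show ?thesis by (simp add: \<psi>_def c_def)
qed

text \<open>
  The inequality on an interval is used with $m = 0$ up to \<open>y\<close> and with $m = L^{1-p}$ from there on. The
  outer boundary terms vanish, and the sum of the inner ones is the left-hand side.
\<close>

lemma hardy_half_line:
  fixes w w' :: "real \<Rightarrow> real"
  assumes p: "p > 1" and w: "\<And>t. DERIV w t :> w' t" and w': "continuous_on UNIV w'"
    and e: "0 < e" "e \<le> L" "\<And>t. t \<in> {0..e} \<Longrightarrow> w t = 0 \<and> w' t = 0" and L: "w L = 0"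
    and y: "y \<in> {0..L}"
  defines "H \<equiv> (p - 1) / p"
  defines "J \<equiv> \<lambda>t. \<bar>w' t\<bar> powr p - H powr p * (\<bar>w t\<bar> powr p / \<bar>t\<bar> powr p)"
  assumes J: "J integrable_on {0..L}"
  shows "H powr (p - 1) * L powr (1 - p) * \<bar>w y\<bar> powr p \<le> integral {0..L} J"
proof -
  have *: "H powr (p - 1) * L powr (1 - p) * \<bar>w y\<bar> powr p \<le> integral {0..L} J" if y: "y \<in> {e..L}" for y
  proof -
    have L0: "L > 0" using e by simp
    have "L powr (1 - p) \<le> y powr (1 - p)" using y e p by (intro powr_mono2') auto
    have "integral {0..e} J = integral {0..e} (\<lambda>_. 0)"
      by (intro integral_cong) (use p e(3) in \<open>auto simp: J_def\<close>)
    moreover have "integral {0..e} J + integral {e..y} J = integral {0..y} J"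
      by (rule Henstock_Kurzweil_Integration.integral_combine)
        (use e y in \<open>auto intro: integrable_on_subinterval[OF J]\<close>)
    moreover have "integral {0..y} J + integral {y..L} J = integral {0..L} J"
      by (rule Henstock_Kurzweil_Integration.integral_combine[OF _ _ J]) (use e y in auto)
    moreover have "H powr (p - 1) * y powr (1 - p) * \<bar>w y\<bar> powr p \<le> integral {e..y} J"
      using hardy_interval[OF p w w', of e y 0] e y p by (simp add: J_def H_def)
    moreover have "- (H powr (p - 1) * (y powr (1 - p) - L powr (1 - p)) * \<bar>w y\<bar> powr p) \<le> integral {y..L} J"
      using hardy_interval[OF p w w', of y L "L powr (1 - p)"] e y p L by (simp add: J_def H_def)
    ultimately show ?thesis by (simp add: algebra_simps)
  qed
  show ?thesis
  proof (cases "y \<ge> e")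
    case False
    then have "w y = w e" using y e by auto
    then show ?thesis using *[of e] e by simp
  qed (use * y in auto)
qed

text \<open>
  Transports one-dimensional integrals to the real line.
\<close>

lemma lborel_dim_1:
  assumes "Basis = {e :: 'a::euclidean_space}"
  shows "(lborel :: 'a measure) = distr lborel borel (\<lambda>t::real. t *\<^sub>R e)"
proof (rule lborel_eqI)
  fix l u :: 'a assume le: "\<And>b. b \<in> Basis \<Longrightarrow> l \<bullet> b \<le> u \<bullet> b"
  have lu: "l \<bullet> e \<le> u \<bullet> e" by (rule le) (simp add: assms)
  have ee: "e \<bullet> e = 1" by (rule inner_same_Basis) (simp add: assms)
  have "(\<lambda>t::real. t *\<^sub>R e) -` box l u = {l \<bullet> e<..<u \<bullet> e}"
    using ee by (auto simp: mem_box assms)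
  then show "emeasure (distr lborel borel (\<lambda>t::real. t *\<^sub>R e)) (box l u) = (\<Prod>b\<in>Basis. (u - l) \<bullet> b)"
    using lu by (subst emeasure_distr) (auto simp: inner_diff_left assms)
qed simp

context punctured_C1
begin

text \<open>
  A connected open set of measure $L$ that contains the origin lies in $(-L, L)$, so both half lines are
  covered by \<open>hardy_half_line\<close>. Each contributes a nonnegative amount to the Hardy difference, and the one
  through \<open>x\<close> contributes the left-hand side.
\<close>

lemma sup_le_hardy_dim_1:
  assumes dim: "DIM('a) = 1"
    and \<Omega>: "open \<Omega>" "connected \<Omega>" "0 \<in> \<Omega>" "emeasure lborel \<Omega> < \<infinity>"
    and supp: "K \<subseteq> \<Omega>"
  shows "H powr (p - 1) * measure lborel \<Omega> powr (1 - p) * \<bar>u x\<bar> powr p \<le> hardy"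
proof -
  obtain e :: 'a where e: "Basis = {e}" using dim by (auto simp: card_1_singleton_iff)
  have ee: "e \<bullet> e = 1" "norm e = 1" by (auto intro!: inner_same_Basis norm_Basis simp: e)
  have repr: "(x \<bullet> e) *\<^sub>R e = x" for x :: 'a
    using euclidean_representation[of x] by (simp add: e)
  have H1: "H = (p - 1) / p" using dim by (simp add: H_def)
  define L where "L = measure lborel \<Omega>"
  define F where "F x = norm (g x) powr p - H powr p * quotient x" for x
  have bound: "\<bar>t\<bar> < L" if t: "t *\<^sub>R e \<in> \<Omega>" for t
  proof -
    have weak: "\<bar>t\<bar> \<le> L" if t: "t *\<^sub>R e \<in> \<Omega>" for t
    proof -
      let ?I = "{min 0 t..max 0 t}"
      have "connected ((\<lambda>x. x \<bullet> e) ` \<Omega>)"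
        by (intro connected_continuous_image continuous_intros \<Omega>)
      moreover have "0 \<in> (\<lambda>x. x \<bullet> e) ` \<Omega>" "t \<in> (\<lambda>x. x \<bullet> e) ` \<Omega>"
        using \<Omega>(3) t ee by (auto intro: rev_image_eqI)
      ultimately have sub: "?I \<subseteq> (\<lambda>x. x \<bullet> e) ` \<Omega>"
        by (intro connected_contains_Icc) (auto simp: min_def max_def)
      have "?I \<subseteq> (\<lambda>t. t *\<^sub>R e) -` \<Omega>"
      proof
        fix s assume "s \<in> ?I"
        with sub obtain z where "z \<in> \<Omega>" "s = z \<bullet> e" by auto
        then show "s \<in> (\<lambda>t. t *\<^sub>R e) -` \<Omega>" by (simp add: repr)
      qed
      then have "emeasure lborel ?I \<le> emeasure lborel ((\<lambda>t. t *\<^sub>R e) -` \<Omega>)"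
      proof (rule emeasure_mono)
        have "open ((\<lambda>t. t *\<^sub>R e) -` \<Omega>)" by (intro open_vimage \<Omega> continuous_intros)
        then show "(\<lambda>t. t *\<^sub>R e) -` \<Omega> \<in> sets lborel" by simp
      qed
      also have "\<dots> = emeasure lborel \<Omega>"
        using \<Omega>(1) by (subst lborel_dim_1[OF e]) (simp add: emeasure_distr)
      finally have "ennreal \<bar>t\<bar> \<le> ennreal L"
        using \<Omega>(4) by (auto simp: L_def emeasure_eq_ennreal_measure abs_if min_def max_def split: if_splits)
      then show ?thesis by (simp add: L_def)
    qed
    \<comment> \<open>Openness makes the inequality strict, which is what forces \<open>u\<close> to vanish at distance \<open>L\<close>.\<close>
    have "open ((\<lambda>t. t *\<^sub>R e) -` \<Omega>)" by (intro open_vimage \<Omega> continuous_intros)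
    then obtain \<delta> where \<delta>: "\<delta> > 0" "ball t \<delta> \<subseteq> (\<lambda>t. t *\<^sub>R e) -` \<Omega>"
      using t by (meson open_contains_ball vimageI2)
    then have "t + \<delta> / 2 \<in> ball t \<delta>" "t - \<delta> / 2 \<in> ball t \<delta>" by (auto simp: dist_real_def)
    then have "\<bar>t + \<delta> / 2\<bar> \<le> L" "\<bar>t - \<delta> / 2\<bar> \<le> L" using \<delta>(2) weak by blast+
    then show ?thesis using \<delta>(1) by linarith
  qed
  have L: "L > 0" using bound[of 0] \<Omega>(3) by simp
  have F_zero: "F x = 0" if "x \<notin> \<Omega>" for x
  proof -
    have "x \<notin> K" using that supp by blast
    then show ?thesis using p_gt_1 by (simp add: F_def g_zero u_zero)
  qed
  have cont_F: "continuous_on UNIV F"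
    unfolding F_def by (intro continuous_on_diff continuous_on_mult_left cont_norm_powr cont_g cont_quotient)
  have cont_Fd: "continuous_on UNIV (\<lambda>t::real. F (t *\<^sub>R d))" for d
    by (rule continuous_on_compose2[OF cont_F]) (auto intro!: continuous_intros)
  have int_Fd: "(\<lambda>t. F (t *\<^sub>R d)) integrable_on {a..b}" for d a b
    using continuous_on_subset[OF cont_Fd] by (intro integrable_continuous_real) auto
  have half: "H powr (p - 1) * L powr (1 - p) * \<bar>u (y *\<^sub>R d)\<bar> powr p \<le> integral {0..L} (\<lambda>t. F (t *\<^sub>R d))"
    if d: "d = e \<or> d = - e" and y: "y \<in> {0..L}" for d y
  proof -
    have gd: "\<bar>g x \<bullet> d\<bar> = norm (g x)" for x
      using d ee repr[of "g x"] by (metis abs_minus_cancel inner_minus_right mult.right_neutral norm_scaleR)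
    have nd: "norm (t *\<^sub>R d) = \<bar>t\<bar>" for t using d ee by auto
    have F: "F (t *\<^sub>R d) = \<bar>g (t *\<^sub>R d) \<bullet> d\<bar> powr p - ((p - 1) / p) powr p * (\<bar>u (t *\<^sub>R d)\<bar> powr p / \<bar>t\<bar> powr p)" for t
      by (simp only: F_def gd nd H1)
    have "open (- K)" using compact_K by (simp add: compact_imp_closed open_Compl)
    then obtain \<delta> where \<delta>: "\<delta> > 0" "ball 0 \<delta> \<subseteq> - K"
      using zero_notin_K by (meson ComplI open_contains_ball)
    define \<epsilon> where "\<epsilon> = min (\<delta> / 2) L"
    have \<epsilon>: "0 < \<epsilon>" "\<epsilon> \<le> L" using \<delta> L by (auto simp: \<epsilon>_def)
    have near: "u (t *\<^sub>R d) = 0 \<and> g (t *\<^sub>R d) \<bullet> d = 0" if "t \<in> {0..\<epsilon>}" for t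
    proof -
      have "t *\<^sub>R d \<in> ball 0 \<delta>" using that \<delta>(1) nd[of t] by (auto simp: \<epsilon>_def)
      then have "t *\<^sub>R d \<notin> K" using \<delta>(2) by blast
      then show ?thesis by (simp add: u_zero g_zero)
    qed
    have "L *\<^sub>R d \<notin> \<Omega>"
      using d bound[of L] bound[of "- L"] L by auto
    then have "u (L *\<^sub>R d) = 0" using supp u_zero by blast
    moreover have "DERIV (\<lambda>t. u (t *\<^sub>R d)) t :> g (t *\<^sub>R d) \<bullet> d" for t
      using has_derivative_along_segment[of u 0 t d] gderiv
      by (simp add: has_real_derivative_iff_has_vector_derivative)
    moreover have "continuous_on UNIV (\<lambda>t::real. g (t *\<^sub>R d) \<bullet> d)"
      by (intro continuous_intros continuous_on_compose2[OF cont_g]) auto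
    ultimately show ?thesis
      using hardy_half_line[of p "\<lambda>t. u (t *\<^sub>R d)" "\<lambda>t. g (t *\<^sub>R d) \<bullet> d" \<epsilon> L y] p_gt_1 \<epsilon> near y int_Fd[of d 0 L]
      by (simp add: F H1)
  qed
  have "hardy = (LINT x|lborel. F x)"
    unfolding F_def hardy_def using integrable_g integrable_quotient
    by (simp only: Bochner_Integration.integral_diff integrable_mult_right integral_mult_right_zero)
  also have "\<dots> = integral\<^sup>L (distr lborel borel (\<lambda>t::real. t *\<^sub>R e)) F"
    by (subst lborel_dim_1[OF e]) (rule refl)
  also have "\<dots> = (LINT t|lborel. F (t *\<^sub>R e))"
    by (intro integral_distr borel_measurable_continuous_onI[OF cont_F]) simp
  also have "\<dots> = integral UNIV (\<lambda>t. F (t *\<^sub>R e))"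
  proof (rule integral_lborel[symmetric], rule integrable_compact_support[OF cont_Fd, of "{-L..L}"])
    show "F (t *\<^sub>R e) = 0" if "t \<notin> {-L..L}" for t
      using bound[of t] that by (intro F_zero) auto
  qed simp
  also have "\<dots> = integral UNIV (\<lambda>t. if t \<in> {-L..L} then F (t *\<^sub>R e) else 0)"
  proof (intro arg_cong2[where f = integral] refl ext)
    show "F (t *\<^sub>R e) = (if t \<in> {-L..L} then F (t *\<^sub>R e) else 0)" for t
      using bound[of t] by (auto intro!: F_zero)
  qed
  also have "\<dots> = integral {-L..L} (\<lambda>t. F (t *\<^sub>R e))" by (rule integral_restrict_UNIV)
  also have "\<dots> = integral {-L..0} (\<lambda>t. F (t *\<^sub>R e)) + integral {0..L} (\<lambda>t. F (t *\<^sub>R e))"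
    by (rule Henstock_Kurzweil_Integration.integral_combine[symmetric]) (use L int_Fd in auto)
  also have "integral {-L..0} (\<lambda>t. F (t *\<^sub>R e)) = integral {0..L} (\<lambda>t. F (t *\<^sub>R (- e)))"
    using Henstock_Kurzweil_Integration.integral_reflect_real[of L 0 "\<lambda>t. F (t *\<^sub>R (- e))"] by simp
  finally have hardy: "hardy = integral {0..L} (\<lambda>t. F (t *\<^sub>R (- e))) + integral {0..L} (\<lambda>t. F (t *\<^sub>R e))" .
  have half_nonneg: "0 \<le> integral {0..L} (\<lambda>t. F (t *\<^sub>R d))" if "d = e \<or> d = - e" for d
    using half[OF that, of 0] L p_gt_1 by simp
  define y where "y = \<bar>x \<bullet> e\<bar>"
  define d where "d = (if x \<bullet> e \<ge> 0 then e else - e)"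
  have d: "d = e \<or> d = - e" by (simp add: d_def)
  have x: "x = y *\<^sub>R d" using repr[of x] by (simp add: y_def d_def)
  have "H powr (p - 1) * L powr (1 - p) * \<bar>u x\<bar> powr p \<le> integral {0..L} (\<lambda>t. F (t *\<^sub>R d))"
  proof (cases "x \<in> \<Omega>")
    case True
    then have "y \<in> {0..L}" using bound[of "x \<bullet> e"] by (simp add: repr y_def)
    then show ?thesis unfolding x by (rule half[OF d])
  next
    case False
    then have "u x = 0" using supp u_zero by blast
    then show ?thesis using half_nonneg[OF d] p_gt_1 by simp
  qed
  also have "\<dots> \<le> hardy"
    unfolding hardy using half_nonneg[of e] half_nonneg[of "- e"] d by auto
  finally show ?thesis by (simp add: L_def)
qed

end

section \<open>The Hardy-Morrey inequality\<close>

lemma powr_minus_less_one: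
  fixes x r :: real
  assumes "x > 1" "r > 0"
  shows "x powr (- r) < 1"
  using powr_less_mono[of "- r" 0 x] assms by simp

context punctured_C1
begin

lemma exponent_eq: "1 / real DIM('a) - 1 / p = H / real DIM('a)"
  using p_gt_1 by (simp add: H_def field_simps)

theorem hardy_morrey_dim_1:
  assumes dim: "DIM('a) = 1"
    and \<Omega>: "open \<Omega>" "connected \<Omega>" "0 \<in> \<Omega>" "emeasure lborel \<Omega> < \<infinity>" "measure lborel \<Omega> > 0" "K \<subseteq> \<Omega>"
  shows "0 \<le> hardy"
    and "\<bar>u x\<bar> \<le> H powr (- H) * measure lborel \<Omega> powr (1 / real DIM('a) - 1 / p) * hardy powr (1 / p)"
proof -
  let ?m = "measure lborel \<Omega>"
  have bound: "H powr (p - 1) * ?m powr (1 - p) * \<bar>u x\<bar> powr p \<le> hardy" for x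
    using sup_le_hardy_dim_1[OF dim \<Omega>(1-4,6)] .
  show "0 \<le> hardy" using bound[of 0] p_gt_1 by simp
  have "(H powr (p - 1) * ?m powr (1 - p) * \<bar>u x\<bar> powr p) powr (1 / p) \<le> hardy powr (1 / p)"
    using p_gt_1 by (intro powr_mono2 bound) auto
  also have "(H powr (p - 1) * ?m powr (1 - p) * \<bar>u x\<bar> powr p) powr (1 / p) = H powr H * ?m powr (- H) * \<bar>u x\<bar>"
  proof -
    have "(p - 1) * (1 / p) = H" "(1 - p) * (1 / p) = - H" "p * (1 / p) = 1"
      using dim p_gt_1 by (auto simp: H_def field_simps)
    then show ?thesis by (simp only: powr_mult powr_powr) simp
  qed
  finally have "\<bar>u x\<bar> \<le> H powr (- H) * ?m powr H * hardy powr (1 / p)"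
    using H_pos \<Omega>(5) by (simp add: powr_minus field_simps)
  then show "\<bar>u x\<bar> \<le> H powr (- H) * ?m powr (1 / real DIM('a) - 1 / p) * hardy powr (1 / p)"
    unfolding exponent_eq using dim by simp
qed

theorem hardy_morrey_dim_ge_2:
  assumes dim: "DIM('a) \<ge> 2"
    and \<Omega>: "open \<Omega>" "emeasure lborel \<Omega> < \<infinity>" "measure lborel \<Omega> > 0" "K \<subseteq> \<Omega>"
  shows "0 \<le> hardy"
    and "\<bar>u x\<bar> \<le> 4 * real DIM('a) * 4 powr H / (H * (1 - (1 + 1 / (2 * real DIM('a))) powr (- H)))
       * 2 powr ((p - 1) / p) * measure lborel \<Omega> powr (1 / real DIM('a) - 1 / p) * hardy powr (1 / p)"
proof -
  let ?B = "LINT x|lborel. norm (remainder x) powr p"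
  have "real DIM('a) \<ge> 2" using dim by simp
  then have p: "p > 2" using p_gt_dim by linarith
  have B: "2 powr (1 - p) * ?B \<le> hardy" by (rule remainder_le_hardy) fact
  moreover have "0 \<le> ?B" by simp
  ultimately show "0 \<le> hardy" by (smt (verit) mult_nonneg_nonneg powr_ge_zero)
  have "?B = 2 powr (p - 1) * (2 powr (1 - p) * ?B)"
    by (simp flip: powr_add mult.assoc)
  also have "\<dots> \<le> 2 powr (p - 1) * hardy" using B by (intro mult_left_mono) auto
  finally have "remainder_norm \<le> (2 powr (p - 1) * hardy) powr (1 / p)"
    unfolding remainder_norm_def using p by (intro powr_mono2) auto
  also have "\<dots> = 2 powr ((p - 1) / p) * hardy powr (1 / p)"
    by (simp add: powr_mult powr_powr)
  finally have remainder_norm: "remainder_norm \<le> 2 powr ((p - 1) / p) * hardy powr (1 / p)" .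
  let ?C = "4 * real DIM('a) * 4 powr H / (H * (1 - (1 + 1 / (2 * real DIM('a))) powr (- H)))"
  have "(1 + 1 / (2 * real DIM('a))) powr (- H) < 1"
    using H_pos by (intro powr_minus_less_one) auto
  then have C: "?C \<ge> 0" using H_pos by (intro divide_nonneg_nonneg mult_nonneg_nonneg) auto
  have "\<bar>u x\<bar> \<le> ?C * measure lborel \<Omega> powr (H / real DIM('a)) * remainder_norm"
    by (rule sup_le_remainder) (use \<Omega> u_zero in auto)
  also have "\<dots> \<le> ?C * measure lborel \<Omega> powr (H / real DIM('a)) * (2 powr ((p - 1) / p) * hardy powr (1 / p))"
    using C by (intro mult_left_mono remainder_norm mult_nonneg_nonneg) auto
  finally show "\<bar>u x\<bar> \<le> ?C * 2 powr ((p - 1) / p) * measure lborel \<Omega> powr (1 / real DIM('a) - 1 / p) * hardy powr (1 / p)"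
    unfolding exponent_eq by (simp only: mult_ac)
qed

end

text \<open>
  Riesz representation of the derivative, in coordinates.
\<close>

lemma differentiable_imp_GDERIV:
  fixes f :: "'a::euclidean_space \<Rightarrow> real"
  assumes "f differentiable (at x)"
  shows "GDERIV f x :> gradient f x"
proof -
  obtain f' where f': "(f has_derivative f') (at x)"
    using assms by (auto simp: differentiable_def)
  interpret linear f' using f' by (rule has_derivative_linear)
  have "f' = (\<lambda>h. h \<bullet> (\<Sum>b\<in>Basis. f' b *\<^sub>R b))"
  proof
    fix h
    have "f' h = f' (\<Sum>b\<in>Basis. (h \<bullet> b) *\<^sub>R b)" by (simp add: euclidean_representation)
    also have "\<dots> = h \<bullet> (\<Sum>b\<in>Basis. f' b *\<^sub>R b)"
      by (simp add: sum scale inner_sum_right mult.commute)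
    finally show "f' h = h \<bullet> (\<Sum>b\<in>Basis. f' b *\<^sub>R b)" .
  qed
  with f' have "GDERIV f x :> (\<Sum>b\<in>Basis. f' b *\<^sub>R b)"
    unfolding gderiv_def by (rule back_subst)
  then show ?thesis using gradient_eq[of f x] by simp
qed

text \<open>
  Membership in the space of test functions controls \<open>u\<close> only on the punctured domain; elsewhere \<open>u\<close>
  vanishes on the complement of its support, an open set. Together the two open sets cover the space.
\<close>

lemma test_function_punctured_C1:
  fixes u :: "real ^ 'n \<Rightarrow> real"
  assumes "open \<Omega>" "u \<in> test_functions (\<Omega> - {0})" "p > real CARD('n)"
  shows "punctured_C1 u (gradient u) (closure {x. u x \<noteq> 0}) p"
proof
  let ?K = "closure {x. u x \<noteq> 0}" and ?U = "\<Omega> - {0}"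
  have U: "open ?U" using assms(1) by blast
  have K: "compact ?K" "?K \<subseteq> ?U" and "Ck_on 1 ?U u"
    using assms(2) unfolding test_functions_def by blast+
  then have diff: "u differentiable_on ?U" and cont: "\<And>i. continuous_on ?U (\<lambda>x. gradient u x $ i)"
    by simp_all
  show "compact ?K" "0 \<notin> ?K" using K by auto
  show zero: "u x = 0" if "x \<notin> ?K" for x
    using that closure_subset[of "{x. u x \<noteq> 0}"] by auto
  have open_K: "open (- ?K)" by (simp add: open_Compl)
  show "p > real DIM(real ^ 'n)" using assms(3) by simp
  have outside: "GDERIV u x :> 0" if "x \<in> - ?K" for x
    by (rule GDERIV_zero_outside[OF closed_closure zero ComplD[OF that]])
  show "GDERIV u x :> gradient u x" for x
  proof (cases "x \<in> ?U")
    case True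
    then have "u differentiable (at x)"
      using diff U by (metis at_within_open differentiable_on_def)
    then show ?thesis by (rule differentiable_imp_GDERIV)
  next
    case False
    then have "x \<in> - ?K" using K by blast
    from outside[OF this] show ?thesis using gradient_eq by metis
  qed
  have "continuous_on ?U (\<lambda>x. \<chi> i. gradient u x $ i)"
    by (intro continuous_on_vec_lambda cont)
  moreover have "continuous_on (- ?K) (gradient u)"
    using gradient_eq[OF outside] by (auto intro: continuous_on_eq[where f = "\<lambda>_. 0"])
  ultimately have "continuous_on (?U \<union> - ?K) (gradient u)"
    using U open_K by (intro continuous_on_open_Un) auto
  moreover have "?U \<union> - ?K = UNIV" using K by blast
  ultimately show "continuous_on UNIV (gradient u)" by simp
qed

lemma hardy_difference_eq:
  fixes u :: "real ^ 'n \<Rightarrow> real"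
  assumes "punctured_C1 u (gradient u) K p" "K \<subseteq> \<Omega>"
  shows "hardy_difference p \<Omega> u = punctured_C1.hardy u (gradient u) p"
proof -
  interpret punctured_C1 u "gradient u" K p by fact
  have restrict: "(LINT x:\<Omega>|lborel. F x) = (LINT x|lborel. F x)" if F: "\<And>x. x \<notin> K \<Longrightarrow> F x = 0" for F :: "real ^ 'n \<Rightarrow> real"
  proof -
    have "indicator \<Omega> x *\<^sub>R F x = F x" for x
      using F[of x] assms(2) by (cases "x \<in> \<Omega>") auto
    then show ?thesis by (simp only: set_lebesgue_integral_def)
  qed
  have "(LINT x:\<Omega>|lborel. norm (gradient u x) powr p) = (LINT x|lborel. norm (gradient u x) powr p)"
    by (rule restrict) (use p_gt_1 in \<open>simp add: g_zero\<close>)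
  moreover have "(LINT x:\<Omega>|lborel. \<bar>u x\<bar> powr p / norm x powr p) = (LINT x|lborel. \<bar>u x\<bar> powr p / norm x powr p)"
    by (rule restrict) (use p_gt_1 in \<open>simp add: u_zero\<close>)
  ultimately show ?thesis
    by (simp add: hardy_difference_def hardy_def H_def)
qed

theorem theoremA:
  fixes p :: real
  assumes "p > real CARD('n::finite)"
  shows "\<exists>C>0. \<forall>\<Omega> :: (real ^ 'n) set.
           open \<Omega> \<and> connected \<Omega> \<and> 0 \<in> \<Omega> \<and> emeasure lborel \<Omega> < \<infinity> \<longrightarrow>
           (\<forall>u \<in> test_functions (\<Omega> - {0}).
              0 \<le> hardy_difference p \<Omega> u \<and>
              (SUP x\<in>\<Omega>. \<bar>u x\<bar>)
                \<le> C * measure lborel \<Omega> powr (1 / real CARD('n) - 1 / p)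
                    * hardy_difference p \<Omega> u powr (1 / p))"
proof -
  define n where "n = CARD('n)"
  have n: "n \<ge> 1" unfolding n_def by (simp add: Suc_leI)
  define \<eta> where "\<eta> = (p - real n) / p"
  have \<eta>: "\<eta> > 0" using assms n by (simp add: \<eta>_def n_def)
  define C where "C = (if n = 1 then \<eta> powr (- \<eta>) else
    4 * real n * 4 powr \<eta> / (\<eta> * (1 - (1 + 1 / (2 * real n)) powr (- \<eta>))) * 2 powr ((p - 1) / p))"
  have "(1 + 1 / (2 * real n)) powr (- \<eta>) < 1"
    using \<eta> n by (intro powr_minus_less_one) auto
  then have "C > 0" using \<eta> n by (simp add: C_def)
  have bound: "0 \<le> hardy_difference p \<Omega> u \<and> (SUP x\<in>\<Omega>. \<bar>u x\<bar>)
      \<le> C * measure lborel \<Omega> powr (1 / real CARD('n) - 1 / p) * hardy_difference p \<Omega> u powr (1 / p)"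
    if \<Omega>: "open \<Omega>" "connected \<Omega>" "0 \<in> \<Omega>" "emeasure lborel \<Omega> < \<infinity>"
      and u: "u \<in> test_functions (\<Omega> - {0})"
    for \<Omega> :: "(real ^ 'n) set" and u
  proof -
    let ?K = "closure {x. u x \<noteq> 0}"
    have K: "?K \<subseteq> \<Omega>" using u by (auto simp: test_functions_def)
    have C1: "punctured_C1 u (gradient u) ?K p"
      using \<Omega>(1) u assms by (rule test_function_punctured_C1)
    interpret punctured_C1 u "gradient u" ?K p by (rule C1)
    have hardy: "hardy_difference p \<Omega> u = hardy"
      using C1 K by (rule hardy_difference_eq)
    have "\<not> negligible \<Omega>" using \<Omega>(1,3) by (auto dest: open_not_negligible)
    then have "\<Omega> \<notin> null_sets lborel"
      using null_sets_completionI negligible_iff_null_sets by blast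
    then have "emeasure lborel \<Omega> \<noteq> 0" using \<Omega>(1) by auto
    then have m: "measure lborel \<Omega> > 0"
      using \<Omega>(4) by (simp add: measure_def enn2real_positive_iff zero_less_iff_neq_zero)
    have dim: "DIM(real ^ 'n) = n" and H_eq: "H = \<eta>"
      by (simp_all add: n_def \<eta>_def H_def)
    have "0 \<le> hardy \<and> (\<forall>x. \<bar>u x\<bar> \<le> C * measure lborel \<Omega> powr (1 / real n - 1 / p) * hardy powr (1 / p))"
    proof (cases "n = 1")
      case True
      then have "DIM(real ^ 'n) = 1" by (simp only: dim)
      from hardy_morrey_dim_1[OF this \<Omega> m K] True show ?thesis
        unfolding dim H_eq C_def by simp
    next
      case False
      then have "DIM(real ^ 'n) \<ge> 2" using n unfolding dim by simp
      from hardy_morrey_dim_ge_2[OF this \<Omega>(1,4) m K] False show ?thesis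
        unfolding dim H_eq C_def by simp
    qed
    then show ?thesis
      unfolding hardy n_def using \<Omega>(3) by (blast intro: cSUP_least)
  qed
  show ?thesis
  proof (intro exI[of _ C] conjI[of "C > 0"] allI impI ballI)
    show "C > 0" by fact
    fix \<Omega> :: "(real ^ 'n) set" and u
    assume "open \<Omega> \<and> connected \<Omega> \<and> 0 \<in> \<Omega> \<and> emeasure lborel \<Omega> < \<infinity>" "u \<in> test_functions (\<Omega> - {0})"
    then show "0 \<le> hardy_difference p \<Omega> u \<and> (SUP x\<in>\<Omega>. \<bar>u x\<bar>)
      \<le> C * measure lborel \<Omega> powr (1 / real CARD('n) - 1 / p) * hardy_difference p \<Omega> u powr (1 / p)"
      using bound[of \<Omega> u] by fast
  qed
qed

end
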